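(* Let $T\subset\mathbb R^d$ be a simplicial or box-type element, $p\in\mathbb N$, and let $v\in\mathcal P_p(T)$ be a polynomial of degree at most $p$. Set $\delta_T:=\max\{|\mathbf x|:\mathbf x\in\bar T\}$. Then, for each face $F\subset\partial T$, $$\int_Fv^2(\mathbf s)\,\mathrm e^{-|\mathbf s|^2/2}\,\mathrm d\mathbf s\le c_{\rm inv}(\delta_T)\frac{p^2}{h_T}\int_Tv^2(\mathbf x)\,\mathrm e^{-|\mathbf x|^2/2}\,\mathrm d\mathbf x,$$ with $$c_{\rm inv}(\delta_T):=\frac{M_T^F\,h_T\,\big(h_T^2+2\delta_Th_T+2p+6\big)^2}{4\rho_T\,p^2\,\min_\theta\sin\theta},$$ where $\theta$ denotes the angles of $T$ and $\rho_T$ the radius of the largest inscribed ball of $T$.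
   Context: $h_T=\operatorname{diam}(T)$. A box-type element is a linearly mapped hypercube. For a simplicial $T$ and a face $F$, $M_T^F$ is the number of non-overlapping subfaces $F_1,\dots,F_{M_T^F}$ whose union is $F$ and which are such that each $F_i$ is one base of an oblique prism $\underline T_i=\{\mathbf x_{F_i}+t\mathbf b_{F_i}:\mathbf x_{F_i}\in F_i,\ t\in(0,1)\}\subset T$, with $\mathbf b_{F_i}\in\mathbb R^d$, whose second base lies in the section of $T$ parallel to $F$ at half the height of $T$ over $F$ (for $d=2$, $M_T^F=2$, the two halves of $F$; for $d=3$, $M_T^F=7$: the three corner triangles of the midpoint subdivision of $F$ together with the four triangles of the midpoint subdivision of its central triangle). A box-type $T$ is itself such a prism with base $F$, and $M_T^F=1$. The angles $\theta$ of $T$ are understood to include the angles between the axes $\mathbf b_{F_i}$ and the hyperplane of $F_i$; so $|\hat F_i|/|F_i|\ge\min_\theta\sin\theta$, where $\hat F_i$ is the base of the right-angle prism with the same axis $\mathbf b_{F_i}$ obtained from $\underline T_i$ by a shear transformation and $|\cdot|$ is $(d-1)$-dimensional volume. *)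

theory Defs
  imports "HOL-Analysis.Analysis"
begin

text \<open>
  Elements are closed, full-dimensional subsets of \<open>real^'n\<close>, so \<open>d = CARD('n)\<close>, \<open>h\<^sub>T\<close> is
  \<open>diameter T\<close>, and the faces over which traces are taken are those of dimension \<open>d - 1\<close>,
  i.e. \<open>F facet_of T\<close>.
\<close>

definition simplicial_element :: "(real^'n) set \<Rightarrow> bool" where
  "simplicial_element T \<longleftrightarrow> int CARD('n) simplex T"

definition box_element :: "(real^'n) set \<Rightarrow> bool" where
  "box_element T \<longleftrightarrow>
     (\<exists>(A :: real^'n^'n) a. invertible A \<and> T = (\<lambda>x. a + A *v x) ` cbox 0 One)"

text \<open>Polynomial functions of total degree at most \<open>p\<close>, by multi-indices \<open>\<alpha>\<close>.\<close>

definition poly_space :: "nat \<Rightarrow> (real^'n \<Rightarrow> real) set" where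
  "poly_space p =
     {v. \<exists>c :: ('n \<Rightarrow> nat) \<Rightarrow> real.
           \<forall>x. v x = (\<Sum>\<alpha> \<in> {\<alpha>. (\<Sum>i\<in>UNIV. \<alpha> i) \<le> p}. c \<alpha> * (\<Prod>i\<in>UNIV. (x $ i) ^ \<alpha> i))}"

definition origin_radius :: "(real^'n) set \<Rightarrow> real" where
  "origin_radius T = (SUP x\<in>closure T. norm x)"

definition inradius :: "(real^'n) set \<Rightarrow> real" where
  "inradius T = Sup {r. 0 < r \<and> (\<exists>x. cball x r \<subseteq> T)}"

definition direction :: "(real^'n) set \<Rightarrow> (real^'n) set" where
  "direction S = span {x - y | x y. x \<in> S \<and> y \<in> S}"

text \<open>
  The \<open>k\<close>-dimensional Lebesgue measure on the affine hull of \<open>S\<close>, \<open>k\<close> being its dimension: the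
  image of the product Lebesgue measure under Cartesian coordinates with respect to some
  orthonormal basis of the direction space and some base point. By isometry invariance the
  measure depends on neither choice; for \<open>k = 0\<close> it is the unit point mass.
\<close>

definition flat_measure :: "(real^'n) set \<Rightarrow> (real^'n) measure" where
  "flat_measure S =
     (let B = (SOME B. pairwise orthogonal B \<and> (\<forall>u\<in>B. norm u = 1) \<and> span B = direction S);
          a = (SOME a. a \<in> S)
      in distr (\<Pi>\<^sub>M u\<in>B. lborel) borel (\<lambda>f. a + (\<Sum>u\<in>B. f u *\<^sub>R u)))"

definition half_height_section :: "(real^'n) set \<Rightarrow> (real^'n) set \<Rightarrow> (real^'n) set" where
  "half_height_section T F =
     {y \<in> T. infdist y (affine hull F) = (SUP z\<in>T. infdist z (affine hull F)) / 2}"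

text \<open>
  \<open>prism_family T F M G b\<close>: the subfaces \<open>G i\<close>, \<open>i < M\<close>, with axes \<open>b i\<close>, are as in the
  definition of \<open>M\<^sub>T\<^sup>F\<close>. For a simplex, the two halves of \<open>F\<close> (\<open>d = 2\<close>) and the seven triangles
  obtained by midpoint subdivision (\<open>d = 3\<close>) are instances, with \<open>M = 2\<close> and \<open>M = 7\<close>. In
  general the count depends on the family, which is therefore kept as a parameter.
\<close>

definition simplicial_prisms ::
    "(real^'n) set \<Rightarrow> (real^'n) set \<Rightarrow> nat \<Rightarrow> (nat \<Rightarrow> (real^'n) set) \<Rightarrow> (nat \<Rightarrow> real^'n) \<Rightarrow> bool"
  where
  "simplicial_prisms T F M G b \<longleftrightarrow>
     (\<Union>i<M. G i) = F \<and>
     (\<forall>i<M. polytope (G i) \<and> aff_dim (G i) = int CARD('n) - 1) \<and>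
     (\<forall>i<M. \<forall>j<M. i \<noteq> j \<longrightarrow> rel_interior (G i) \<inter> rel_interior (G j) = {}) \<and>
     (\<forall>i<M. {x + t *\<^sub>R b i | x t. x \<in> G i \<and> 0 < t \<and> t < 1} \<subseteq> T) \<and>
     (\<forall>i<M. {x + b i | x. x \<in> G i} \<subseteq> half_height_section T F)"

definition box_prism ::
    "(real^'n) set \<Rightarrow> (real^'n) set \<Rightarrow> nat \<Rightarrow> (nat \<Rightarrow> (real^'n) set) \<Rightarrow> (nat \<Rightarrow> real^'n) \<Rightarrow> bool"
  where
  "box_prism T F M G b \<longleftrightarrow>
     M = 1 \<and> G 0 = F \<and> T = {x + t *\<^sub>R b 0 | x t. x \<in> F \<and> 0 \<le> t \<and> t \<le> 1}"

definition prism_family ::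
    "(real^'n) set \<Rightarrow> (real^'n) set \<Rightarrow> nat \<Rightarrow> (nat \<Rightarrow> (real^'n) set) \<Rightarrow> (nat \<Rightarrow> real^'n) \<Rightarrow> bool"
  where
  "prism_family T F M G b \<longleftrightarrow>
     simplicial_element T \<and> simplicial_prisms T F M G b \<or>
     box_element T \<and> box_prism T F M G b"

definition vector_angle :: "real^'n \<Rightarrow> real^'n \<Rightarrow> real" where
  "vector_angle u w = arccos (u \<bullet> w / (norm u * norm w))"

text \<open>
  Angle in \<open>[0, \<pi>/2]\<close> between a vector and the hyperplane of \<open>S\<close>: its sine is the distance of
  the tip of the vector from the parallel hyperplane through the origin over its length.
\<close>

definition hyperplane_angle :: "real^'n \<Rightarrow> (real^'n) set \<Rightarrow> real" where
  "hyperplane_angle u S = arcsin (infdist u (direction S) / norm u)"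

definition axis_angles ::
    "nat \<Rightarrow> (nat \<Rightarrow> (real^'n) set) \<Rightarrow> (nat \<Rightarrow> real^'n) \<Rightarrow> real set" where
  "axis_angles M G b = {hyperplane_angle (b i) (G i) | i. i < M}"

text \<open>Angles at a vertex \<open>x\<close> between two distinct edges emanating from it.\<close>

definition edge_angles :: "(real^'n) set \<Rightarrow> real set" where
  "edge_angles T =
     {vector_angle (y - x) (z - x) | x y z.
        closed_segment x y edge_of T \<and> closed_segment x z edge_of T \<and> y \<noteq> z}"

definition outer_normal :: "(real^'n) set \<Rightarrow> (real^'n) set \<Rightarrow> real^'n \<Rightarrow> bool" where
  "outer_normal T F n \<longleftrightarrow>
     norm n = 1 \<and> (\<exists>c. T \<subseteq> {x. n \<bullet> x \<le> c} \<and> F = T \<inter> {x. n \<bullet> x = c})"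

text \<open>
  Interior angles between adjacent facets. In the elements considered here, distinct
  facets that meet do so in a face of dimension \<open>d - 2\<close>.
\<close>

definition dihedral_angles :: "(real^'n) set \<Rightarrow> real set" where
  "dihedral_angles T =
     {pi - vector_angle m n | m n F G.
        F facet_of T \<and> G facet_of T \<and> F \<noteq> G \<and> F \<inter> G \<noteq> {} \<and>
        outer_normal T F m \<and> outer_normal T G n}"

definition c_inv :: "(real^'n) set \<Rightarrow> nat \<Rightarrow> nat \<Rightarrow> real set \<Rightarrow> real" where
  "c_inv T p M \<Theta> =
     real M * diameter T *
       ((diameter T)\<^sup>2 + 2 * origin_radius T * diameter T + 2 * real p + 6)\<^sup>2 /
     (4 * inradius T * (real p)\<^sup>2 * (MIN \<theta>\<in>\<Theta>. sin \<theta>))"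

end

theory Submission
  imports Defs "HOL-Computational_Algebra.Polynomial"
begin

text \<open>
  On the segment \<open>x + t b\<close>, \<open>0 \<le> t \<le> 1\<close>, of a prism the weight \<open>exp (- |x + t b|\<^sup>2 / 2)\<close> is at least
  \<open>exp (- |x|\<^sup>2 / 2) exp (- K t)\<close> with \<open>K = \<delta> h + h\<^sup>2 / 2\<close>. Since \<open>(1 - t)\<^sup>m \<le> exp (- K t / 2)\<close> for
  \<open>m \<ge> K / 2\<close>, the weighted trace inequality in one variable reduces to the unweighted one,
  \<open>q(0)\<^sup>2 \<le> (k + 1)\<^sup>2 \<integral> q\<^sup>2\<close> for degree at most \<open>k\<close>, applied to \<open>(1 - t)\<^sup>m v(x + t b)\<close>; the latter
  follows from Cauchy--Schwarz and the reproducing kernel of evaluation at \<open>0\<close>, whose square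
  norm is \<open>(k + 1)\<^sup>2\<close>. Integrating over the base of the prism in oblique coordinates costs
  the factor \<open>1 / |n \<bullet> b|\<close>, the reciprocal height of the prism; the height is at least the
  inradius because \<open>T\<close> is at most twice as high over \<open>F\<close> as the prism. Each of the \<open>M\<close> prisms
  lies in \<open>T\<close>. The angles only weaken the bound: all their sines lie in \<open>(0, 1]\<close>.
\<close>

section \<open>Trace inequality on the unit interval\<close>

text \<open>Up to sign this is the \<open>k\<close>-th finite difference of \<open>g\<close> at
  \<open>0\<close>, which kills degrees below \<open>k\<close>. Induction: writing
  \<open>g = a + x h\<close>, the constant part vanishes by the binomial theorem, and the absorption
  identity \<open>(k+1 choose j+1) (j+1) = (k+1) (k choose j)\<close> turns the rest into the same
  sum for \<open>k\<close> and \<open>h(x + 1)\<close>, whose degree is smaller by one.\<close>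

lemma alternating_binomial_poly_sum:
  fixes g :: "real poly"
  assumes "degree g < k"
  shows "(\<Sum>j\<le>k. (-1) ^ j * real (k choose j) * poly g (real j)) = 0"
  using assms
proof (induction k arbitrary: g)
  case 0
  then show ?case by simp
next
  case (Suc k)
  obtain a h where g: "g = pCons a h" by (cases g)
  define h1 where "h1 = pcompose h [:1, 1:]"
  have h1: "poly h1 (real j) = poly h (real (Suc j))" for j
    by (simp add: h1_def poly_pcompose add.commute)
  have "(\<Sum>j\<le>Suc k. (-1) ^ j * real (Suc k choose j) * poly g (real j)) =
      a * (\<Sum>j\<le>Suc k. (-1) ^ j * real (Suc k choose j)) +
      (\<Sum>j\<le>Suc k. (-1) ^ j * real (Suc k choose j) * (real j * poly h (real j)))"
    by (simp only: g poly_pCons sum_distrib_left flip: sum.distrib) (simp add: algebra_simps)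
  also have "(\<Sum>j\<le>Suc k. (-1) ^ j * real (Suc k choose j)) = 0"
    using choose_alternating_sum[of "Suc k", where 'a = real] by simp
  also have "(\<Sum>j\<le>Suc k. (-1) ^ j * real (Suc k choose j) * (real j * poly h (real j)))
      = (\<Sum>j\<le>k. (-1) ^ Suc j * (real (Suc k choose Suc j) * real (Suc j)) * poly h (real (Suc j)))"
    by (subst sum.atMost_Suc_shift) (simp add: algebra_simps)
  also have "\<dots> = (\<Sum>j\<le>k. - (real (Suc k) * ((-1) ^ j * real (k choose j) * poly h1 (real j))))"
  proof (rule sum.cong[OF refl])
    fix j
    have "real (Suc k choose Suc j) * real (Suc j) = real (Suc k) * real (k choose j)"
      using Suc_times_binomial_eq[of k j] by (metis of_nat_mult)
    then show "(-1) ^ Suc j * (real (Suc k choose Suc j) * real (Suc j)) * poly h (real (Suc j))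
        = - (real (Suc k) * ((-1) ^ j * real (k choose j) * poly h1 (real j)))"
      by (simp only: h1) simp
  qed
  also have "\<dots> = - (real (Suc k) * (\<Sum>j\<le>k. (-1) ^ j * real (k choose j) * poly h1 (real j)))"
    by (simp add: sum_negf sum_distrib_left)
  also have "(\<Sum>j\<le>k. (-1) ^ j * real (k choose j) * poly h1 (real j)) = 0"
  proof (cases "h = 0")
    case True
    then show ?thesis by (simp add: h1_def)
  next
    case False
    then have "degree h1 < k" using Suc.prems by (simp add: g h1_def degree_pcompose)
    then show ?thesis by (rule Suc.IH)
  qed
  finally show ?case by simp
qed


section \<open>Integrals of polynomials over the unit interval\<close>

definition unit_integral :: "real poly \<Rightarrow> real" where
  "unit_integral q = integral {0..1} (poly q)"

lemma poly_integrable_on [simp]: "poly (q :: real poly) integrable_on {a..b}"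
  by (intro integrable_continuous_interval continuous_intros)

lemma unit_integral_add: "unit_integral (q + r) = unit_integral q + unit_integral r"
  by (simp add: unit_integral_def flip: integral_add) (simp add: poly_add[abs_def])

lemma unit_integral_smult: "unit_integral (smult c q) = c * unit_integral q"
  by (simp add: unit_integral_def poly_smult[abs_def])

lemma unit_integral_sum: "unit_integral (\<Sum>i\<in>I. f i) = (\<Sum>i\<in>I. unit_integral (f i))"
  by (induction I rule: infinite_finite_induct)
     (simp_all add: unit_integral_add, simp_all add: unit_integral_def poly_0[abs_def])

lemma unit_integral_square_nonneg: "0 \<le> unit_integral (q * q)"
  unfolding unit_integral_def by (intro integral_nonneg) auto

lemma unit_integral_monom: "unit_integral (monom 1 n) = 1 / (real n + 1)"
proof -
  have "((\<lambda>x. x ^ n) has_integral (1 ^ Suc n / (real n + 1) - 0 ^ Suc n / (real n + 1))) {0..1::real}"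
  proof (rule fundamental_theorem_of_calculus)
    fix x :: real
    have "((\<lambda>x. x ^ Suc n / (real n + 1)) has_real_derivative x ^ n) (at x within {0..1})"
      by (rule derivative_eq_intros refl | simp)+ (simp add: field_simps)
    then show "((\<lambda>x. x ^ Suc n / (real n + 1)) has_vector_derivative x ^ n) (at x within {0..1})"
      by (simp add: has_real_derivative_iff_has_vector_derivative)
  qed simp
  then show ?thesis
    by (simp add: unit_integral_def poly_monom[abs_def] integral_unique)
qed

text \<open>
  Reproducing kernel of evaluation at \<open>0\<close>. Its coefficients are the residues of
  \<open>(-1)\<^sup>k (k + 1) (z - 1) \<dots> (z - k) / ((z + 1) \<dots> (z + k + 1))\<close>.
\<close>

definition endpoint_kernel :: "nat \<Rightarrow> real poly" where
  "endpoint_kernel k =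
     (\<Sum>j\<le>k. monom ((-1) ^ j * real (k choose j) *
        ((real k + 1) / fact k * (\<Prod>l\<in>{2..k + 1}. real j + real l))) j)"

text \<open>Only the constant coefficient survives, and there the product is
  \<open>2 ... (k+1) = (k+1)!\<close>. By the reproducing property this value is also the square
  norm of the kernel.\<close>

lemma endpoint_kernel_0: "poly (endpoint_kernel k) 0 = (real k + 1)\<^sup>2"
proof -
  have "(\<Prod>l\<in>{2..k+1}. real l) = (\<Prod>l\<in>{1..k+1}. real l)"
    by (subst (2) prod.atLeast_Suc_atMost) (auto simp: numeral_2_eq_2)
  also have "\<dots> = fact (Suc k)"
    by (simp add: fact_prod algebra_simps)
  finally have "(\<Prod>l\<in>{2..k+1}. real l) = (real k + 1) * fact k"
    by (simp add: algebra_simps)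
  moreover have "(\<Sum>j\<le>k. f j * 0 ^ j) = f 0" for f :: "nat \<Rightarrow> real"
    by (subst sum.atMost_shift) simp
  ultimately show ?thesis
    by (simp add: endpoint_kernel_def poly_sum poly_monom power2_eq_square del: prod.cl_ivl_Suc)
qed

lemma degree_endpoint_kernel: "degree (endpoint_kernel k) \<le> k"
  unfolding endpoint_kernel_def
  by (intro degree_sum_le) (auto intro: order_trans[OF degree_monom_le])

lemma degree_prod_linear_le:
  "degree (\<Prod>l\<in>A. [:real l, 1:]) \<le> card A"
  by (cases "finite A") (auto intro: order_trans[OF degree_prod_sum_le])

text \<open>After multiplication by \<open>k + 1\<close>, absorption turns the terms into those of
  the alternating sum of row \<open>k + 1\<close> of Pascal's triangle without its first entry; as
  the full row sums to \<open>0\<close>, what remains is \<open>1\<close>.\<close>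

lemma alternating_reciprocal_sum:
  "(\<Sum>j\<le>k. (-1) ^ j * real (k choose j) / (real j + 1)) = 1 / (real k + 1)"
proof -
  have "(real k + 1) * (\<Sum>j\<le>k. (-1) ^ j * real (k choose j) / (real j + 1))
     = (\<Sum>j\<le>k. (-1) ^ j * real (Suc k choose Suc j))"
    unfolding sum_distrib_left
  proof (rule sum.cong[OF refl])
    fix j
    have "real (Suc k choose Suc j) * (real j + 1) = (real k + 1) * real (k choose j)"
      using Suc_times_binomial_eq[of k j]
      by (metis of_nat_mult of_nat_Suc add.commute)
    then have "real (Suc k choose Suc j) = (real k + 1) * real (k choose j) / (real j + 1)"
      by (simp add: field_simps del: binomial_Suc_Suc)
    then show "(real k + 1) * ((-1) ^ j * real (k choose j) / (real j + 1))
       = (-1) ^ j * real (Suc k choose Suc j)"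
      by simp
  qed
  also have "\<dots> = 1"
    using choose_alternating_sum[OF zero_less_Suc[of k], where 'a = real]
    by (subst (asm) sum.atMost_Suc_shift) (simp add: sum_negf del: binomial_Suc_Suc)
  finally show ?thesis by (simp add: field_simps)
qed

text \<open>Integration divides the \<open>j\<close>-th coefficient by \<open>i + j + 1\<close>. For
  \<open>1 <= i <= k\<close> this cancels a factor of the product \<open>P j\<close>, leaving a
  polynomial in \<open>j\<close> of degree \<open>k - 1\<close>, which the alternating sum kills.
  For \<open>i = 0\<close> no factor equals \<open>j + 1\<close>; division with remainder leaves a
  polynomial part that is killed as well, and a multiple of the alternating reciprocal sum.\<close>

lemma unit_integral_monom_kernel:
  assumes "i \<le> k"
  shows "unit_integral (monom 1 i * endpoint_kernel k) = (if i = 0 then 1 else 0)"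
proof -
  define P where "P = (\<lambda>j. \<Prod>l\<in>{2..k + 1}. real j + real l)"
  have "unit_integral (monom 1 i * endpoint_kernel k) =
    (\<Sum>j\<le>k. unit_integral (monom ((-1) ^ j * real (k choose j) * ((real k + 1) / fact k * P j)) (i + j)))"
    by (simp add: endpoint_kernel_def sum_distrib_left mult_monom unit_integral_sum P_def)
  also have "\<dots> = (\<Sum>j\<le>k. (-1) ^ j * real (k choose j) * ((real k + 1) / fact k * P j) *
      (1 / (real i + real j + 1)))"
  proof (rule sum.cong[OF refl])
    fix j
    have "monom c (i + j) = smult c (monom 1 (i + j))" for c :: real
      by (simp add: smult_monom)
    then show "unit_integral (monom ((-1) ^ j * real (k choose j) * ((real k + 1) / fact k * P j)) (i + j))
       = (-1) ^ j * real (k choose j) * ((real k + 1) / fact k * P j) * (1 / (real i + real j + 1))"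
      by (metis unit_integral_smult unit_integral_monom of_nat_add)
  qed
  also have "\<dots> = (real k + 1) / fact k * (\<Sum>j\<le>k. (-1) ^ j * real (k choose j) * (P j / (real i + real j + 1)))"
    by (simp add: sum_distrib_left mult_ac)
  also have "(\<Sum>j\<le>k. (-1) ^ j * real (k choose j) * (P j / (real i + real j + 1)))
     = (if i = 0 then fact k / (real k + 1) else 0)"
  proof (cases "i = 0")
    case False
    define g where "g = (\<Prod>l\<in>{2..k + 1} - {i + 1}. [:real l, 1:])"
    have "degree g \<le> card ({2..k + 1} - {i + 1})"
      unfolding g_def by (rule degree_prod_linear_le)
    also have "\<dots> < k"
      using False assms by (subst card_Diff_singleton) auto
    finally have deg: "degree g < k" .
    have "P j / (real i + real j + 1) = poly g (real j)" for j
    proof -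
      have "P j = (real j + real (i + 1)) * (\<Prod>l\<in>{2..k + 1} - {i + 1}. real j + real l)"
        unfolding P_def using False assms by (intro prod.remove) auto
      then show ?thesis
        by (simp add: g_def poly_prod add_ac del: prod.cl_ivl_Suc)
    qed
    then show ?thesis
      using alternating_binomial_poly_sum[OF deg] False by simp
  next
    case True
    define R where "R = (\<Prod>l\<in>{2..k + 1}. [:real l, 1:])"
    define q where "q = R - [:fact k:]"
    have R: "poly R (real j) = P j" for j
      by (simp add: R_def P_def poly_prod add.commute del: prod.cl_ivl_Suc)
    \<comment> \<open>The remainder of \<open>R\<close> on division by \<open>x + 1\<close> is its
      value at \<open>-1\<close>, namely \<open>1 * 2 ... k\<close>.\<close>
    have "poly R (-1) = (\<Prod>l\<in>{2..k + 1}. real (l - 1))"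
      unfolding R_def poly_prod by (intro prod.cong) (auto simp: of_nat_diff)
    also have "\<dots> = (\<Prod>l\<in>{1..k}. real l)"
      by (rule prod.reindex_bij_witness[of _ Suc "\<lambda>l. l - 1"]) auto
    finally have "poly R (-1) = fact k"
      by (simp add: fact_prod)
    then have "[:1, 1:] dvd q"
      using poly_eq_0_iff_dvd[of q "-1"] by (simp add: q_def)
    then obtain h where h: "q = [:1, 1:] * h" by (elim dvdE)
    have eq: "P j / (real j + 1) = poly h (real j) + fact k / (real j + 1)" for j
    proof -
      have "P j - fact k = (real j + 1) * poly h (real j)"
        using arg_cong[OF h, of "\<lambda>q. poly q (real j)"] by (simp add: q_def R algebra_simps)
      then show ?thesis by (simp add: field_simps)
    qed
    have z: "(\<Sum>j\<le>k. (-1) ^ j * real (k choose j) * poly h (real j)) = 0"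
    \<comment> \<open>For \<open>k = 0\<close> the product is empty and \<open>h = 0\<close>; no
      degree lies below \<open>0\<close> then, so this case needs separate treatment.\<close>
    proof (cases "h = 0")
      case False
      have "Suc (degree h) = degree q"
        unfolding h using False by (subst degree_mult_eq) auto
      also have "degree q \<le> k"
        unfolding q_def R_def
        by (intro degree_diff_le order_trans[OF degree_prod_linear_le]) auto
      finally show ?thesis by (intro alternating_binomial_poly_sum) simp
    qed simp
    have "(\<Sum>j\<le>k. (-1) ^ j * real (k choose j) * (P j / (real j + 1))) =
       (\<Sum>j\<le>k. (-1) ^ j * real (k choose j) * poly h (real j)) +
       fact k * (\<Sum>j\<le>k. (-1) ^ j * real (k choose j) / (real j + 1))"
      by (simp only: eq) (simp add: sum_distrib_left algebra_simps flip: sum.distrib)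
    then show ?thesis
      using True by (simp add: z alternating_reciprocal_sum)
  qed
  finally show ?thesis by simp
qed

lemma unit_integral_kernel:
  assumes "degree q \<le> k"
  shows "unit_integral (q * endpoint_kernel k) = poly q 0"
proof -
  have "q = (\<Sum>i\<le>k. monom (coeff q i) i)"
    using poly_as_sum_of_monoms'[OF assms] by simp
  also have "\<dots> = (\<Sum>i\<le>k. smult (coeff q i) (monom 1 i))"
    by (simp add: smult_monom)
  finally have "q * endpoint_kernel k = (\<Sum>i\<le>k. smult (coeff q i) (monom 1 i * endpoint_kernel k))"
    by (metis (no_types, lifting) mult_smult_left sum.cong sum_distrib_right)
  then have "unit_integral (q * endpoint_kernel k) = (\<Sum>i\<le>k. coeff q i * (if i = 0 then 1 else 0))"
    by (simp add: unit_integral_sum unit_integral_smult unit_integral_monom_kernel)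
  also have "\<dots> = poly q 0"
    by (simp add: sum.delta' poly_0_coeff_0 if_distrib cong: if_cong)
  finally show ?thesis .
qed

section \<open>Endpoint bounds without and with weight\<close>

lemma poly_endpoint_le:
  assumes "degree q \<le> k"
  shows "(poly q 0)\<^sup>2 \<le> (real k + 1)\<^sup>2 * integral {0..1} (\<lambda>t. (poly q t)\<^sup>2)"
proof -
  define K where "K = endpoint_kernel k"
  define c where "c = (real k + 1)\<^sup>2"
  have c: "0 < c" by (simp add: c_def)
  \<comment> \<open>The minimiser of the square norm of \<open>q + l K\<close>, which is the
    quadratic polynomial \<open>unit_integral (q * q) + 2 l q(0) + l^2 c\<close>; its minimum being
    nonnegative is Cauchy-Schwarz.\<close>
  define l where "l = - poly q 0 / c"
  have "(q + smult l K) * (q + smult l K) = q * q + smult l (q * K) + smult l (q * K) + smult (l\<^sup>2) (K * K)"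
    by (simp only: distrib_left distrib_right mult_smult_left mult_smult_right smult_smult
          smult_add_right power2_eq_square mult.commute[of K q] add.assoc)
  then have "0 \<le> unit_integral (q * q + smult l (q * K) + smult l (q * K) + smult (l\<^sup>2) (K * K))"
    using unit_integral_square_nonneg by metis
  also have "\<dots> = unit_integral (q * q) + 2 * l * poly q 0 + l\<^sup>2 * c"
    unfolding unit_integral_add unit_integral_smult K_def unit_integral_kernel[OF assms]
      unit_integral_kernel[OF degree_endpoint_kernel] endpoint_kernel_0 c_def
    by simp
  also have "\<dots> = unit_integral (q * q) - (poly q 0)\<^sup>2 / c"
    using c by (simp add: l_def power2_eq_square field_simps)
  finally have "(poly q 0)\<^sup>2 \<le> c * unit_integral (q * q)"
    using c by (simp add: field_simps)
  then show ?thesis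
    by (simp add: c_def unit_integral_def power2_eq_square poly_mult[abs_def])
qed

lemma weighted_poly_endpoint_le:
  assumes q: "degree q \<le> p" and K: "0 \<le> K"
  shows "(poly q 0)\<^sup>2 \<le>
    (K + real p + 3)\<^sup>2 * integral {0..1} (\<lambda>t. (poly q t)\<^sup>2 * exp (- K * t))"
proof -
  \<comment> \<open>The least natural number with \<open>2 m >= K\<close>. Rounding up costs at most
    \<open>1\<close>, so \<open>p + m + 1 <= K / 2 + p + 2\<close>. This is relaxed to
    \<open>K + p + 3\<close>, half of the bracket in \<open>c_inv\<close>.\<close>
  define m where "m = nat \<lceil>K / 2\<rceil>"
  have m: "K / 2 \<le> real m" "real m \<le> K / 2 + 1"
    using K by (auto simp: m_def)
  define r where "r = q * [:1, -1:] ^ m"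
  have "degree r \<le> p + m"
    unfolding r_def using q
    by (intro order_trans[OF degree_mult_le] add_mono order_trans[OF degree_power_le]) auto
  then have "(poly r 0)\<^sup>2 \<le> (real (p + m) + 1)\<^sup>2 * integral {0..1} (\<lambda>t. (poly r t)\<^sup>2)"
    by (rule poly_endpoint_le)
  also have "\<dots> \<le> (K + real p + 3)\<^sup>2 * integral {0..1} (\<lambda>t. (poly q t)\<^sup>2 * exp (- K * t))"
  proof (intro mult_mono integral_nonneg integral_le power_mono)
    fix t :: real
    assume t: "t \<in> {0..1}"
    \<comment> \<open>This is where \<open>1 - t <= exp (- t)\<close> enters; squaring later turns
      the exponent \<open>K / 2\<close> into \<open>K\<close>.\<close>
    have "(1 - t) ^ m \<le> exp (- t) ^ m"
      using t exp_ge_add_one_self[of "- t"] by (intro power_mono) auto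
    also have "\<dots> = exp (- real m * t)"
      by (simp flip: exp_of_nat_mult)
    also have "\<dots> \<le> exp (- (K / 2) * t)"
      using mult_right_mono[OF m(1), of t] t by simp
    finally have "((1 - t) ^ m)\<^sup>2 \<le> (exp (- (K / 2) * t))\<^sup>2"
      using t by (intro power_mono) auto
    also have "\<dots> = exp (- K * t)"
      by (simp flip: exp_double)
    finally have "(poly q t)\<^sup>2 * ((1 - t) ^ m)\<^sup>2 \<le> (poly q t)\<^sup>2 * exp (- K * t)"
      by (intro mult_left_mono) auto
    then show "(poly r t)\<^sup>2 \<le> (poly q t)\<^sup>2 * exp (- K * t)"
      by (simp add: r_def poly_power power_mult_distrib)
  qed (use m K in \<open>auto intro!: integrable_continuous_interval continuous_intros\<close>)
  also have "poly r 0 = poly q 0"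
    by (simp add: r_def poly_power)
  finally show ?thesis .
qed

section \<open>Polynomials and the Gaussian weight on segments\<close>

lemma poly_space_on_line:
  assumes "v \<in> poly_space p"
  obtains q where "degree q \<le> p" "\<And>t. poly q t = v (x + t *\<^sub>R b)"
proof -
  obtain c where c: "\<And>x. v x = (\<Sum>\<alpha> \<in> {\<alpha>. (\<Sum>i\<in>UNIV. \<alpha> i) \<le> p}. c \<alpha> * (\<Prod>i\<in>UNIV. (x $ i) ^ \<alpha> i))"
    using assms by (auto simp: poly_space_def)
  define A :: "('a \<Rightarrow> nat) set" where "A = {\<alpha>. (\<Sum>i\<in>UNIV. \<alpha> i) \<le> p}"
  define q where "q = (\<Sum>\<alpha>\<in>A. smult (c \<alpha>) (\<Prod>i\<in>UNIV. [:x $ i, b $ i:] ^ \<alpha> i))"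
  show ?thesis
  proof
    show "poly q t = v (x + t *\<^sub>R b)" for t
      by (simp add: q_def c A_def poly_sum poly_prod poly_power)
    have "degree (\<Prod>i\<in>UNIV. [:x $ i, b $ i:] ^ \<alpha> i) \<le> p" if "\<alpha> \<in> A" for \<alpha>
    proof -
      have "degree (\<Prod>i\<in>UNIV. [:x $ i, b $ i:] ^ \<alpha> i) \<le> (\<Sum>i\<in>UNIV. degree ([:x $ i, b $ i:] ^ \<alpha> i))"
        using degree_prod_sum_le[of UNIV "\<lambda>i. [:x $ i, b $ i:] ^ \<alpha> i"] by (simp add: comp_def)
      also have "\<dots> \<le> (\<Sum>i\<in>UNIV. \<alpha> i)"
        by (intro sum_mono order_trans[OF degree_power_le]) auto
      also have "\<dots> \<le> p" using that by (simp add: A_def)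
      finally show ?thesis .
    qed
    then show "degree q \<le> p"
      \<comment> \<open>The set of multi-indices is in fact finite. The case distinction spares a
        proof of this, since a sum over an infinite set is \<open>0\<close> by convention.\<close>
      unfolding q_def
      by (cases "finite A") (auto intro!: degree_sum_le order_trans[OF degree_smult_le])
  qed
qed

lemma continuous_on_poly_space:
  assumes "v \<in> poly_space p"
  shows "continuous_on S v"
proof -
  obtain c where c: "\<And>x. v x = (\<Sum>\<alpha> \<in> {\<alpha>. (\<Sum>i\<in>UNIV. \<alpha> i) \<le> p}. c \<alpha> * (\<Prod>i\<in>UNIV. (x $ i) ^ \<alpha> i))"
    using assms by (auto simp: poly_space_def)
  show ?thesis
    unfolding c by (intro continuous_intros)
qed

text \<open>The bound is stated with nonnegative extended integrals so that it can be integrated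
  over the base of a prism with no integrability conditions.\<close>

lemma gaussian_trace_le:
  assumes v: "v \<in> poly_space p"
    and K: "\<delta> * h + h\<^sup>2 / 2 = K" "norm x \<le> \<delta>" "norm b \<le> h"
  shows "ennreal ((v x)\<^sup>2 * exp (- (norm x)\<^sup>2 / 2)) \<le>
     ennreal ((K + real p + 3)\<^sup>2) *
     (\<integral>\<^sup>+ t. ennreal ((v (x + t *\<^sub>R b))\<^sup>2 * exp (- (norm (x + t *\<^sub>R b))\<^sup>2 / 2)) * indicator {0..1} t \<partial>lborel)"
proof -
  define g where "g = (\<lambda>x. (v x)\<^sup>2 * exp (- (norm x)\<^sup>2 / 2))"
  have K0: "0 \<le> K"
    using assms by (metis add_nonneg_nonneg mult_nonneg_nonneg norm_ge_zero order_trans zero_le_power2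
        divide_nonneg_pos zero_less_numeral)
  obtain q where q: "degree q \<le> p" "\<And>t. poly q t = v (x + t *\<^sub>R b)"
    using poly_space_on_line[OF v] by blast
  have cont: "continuous_on {0..1} (\<lambda>t. g (x + t *\<^sub>R b))"
    unfolding g_def
    by (intro continuous_intros continuous_on_compose2[OF continuous_on_poly_space[OF v, of UNIV]]) auto
  have int: "((\<lambda>t. g (x + t *\<^sub>R b)) has_integral integral {0..1} (\<lambda>t. g (x + t *\<^sub>R b))) {0..1}"
    using cont by (intro integrable_integral integrable_continuous_interval)
  have "g x = exp (- (norm x)\<^sup>2 / 2) * (poly q 0)\<^sup>2"
    by (simp add: g_def q(2))
  also have "\<dots> \<le> exp (- (norm x)\<^sup>2 / 2) * ((K + real p + 3)\<^sup>2 *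
      integral {0..1} (\<lambda>t. (poly q t)\<^sup>2 * exp (- K * t)))"
    by (intro mult_left_mono weighted_poly_endpoint_le q K0) auto
  also have "\<dots> = (K + real p + 3)\<^sup>2 *
      integral {0..1} (\<lambda>t. exp (- (norm x)\<^sup>2 / 2) * ((poly q t)\<^sup>2 * exp (- K * t)))"
    by simp
  also have "\<dots> \<le> (K + real p + 3)\<^sup>2 * integral {0..1} (\<lambda>t. g (x + t *\<^sub>R b))"
  proof (intro mult_left_mono integral_le)
    fix t :: real
    assume t: "t \<in> {0..1}"
    \<comment> \<open>The quadratic term is linearised by \<open>t * t <= t\<close>, so the exponent
      changes by at most \<open>K t\<close>, and the weight on the segment dominates
      \<open>exp (- K t)\<close> times the weight at \<open>x\<close>.\<close>
    have "(norm (x + t *\<^sub>R b))\<^sup>2 = (norm x)\<^sup>2 + 2 * (t * (x \<bullet> b)) + t * (t * (norm b)\<^sup>2)"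
      by (simp add: power2_norm_eq_inner inner_simps inner_commute algebra_simps)
    also have "t * (x \<bullet> b) \<le> t * (\<delta> * h)"
    proof (intro mult_left_mono)
      have "x \<bullet> b \<le> norm x * norm b" by (rule norm_cauchy_schwarz)
      also have "\<dots> \<le> \<delta> * h" using K norm_ge_zero[of x] norm_ge_zero[of b] by (intro mult_mono) linarith+
      finally show "x \<bullet> b \<le> \<delta> * h" .
    qed (use t in auto)
    also have "t * (t * (norm b)\<^sup>2) \<le> t * (1 * h\<^sup>2)"
      using t K by (intro mult_left_mono mult_mono power_mono) auto
    finally have "(norm (x + t *\<^sub>R b))\<^sup>2 / 2 \<le> (norm x)\<^sup>2 / 2 + K * t"
      using K(1) by (simp add: algebra_simps flip: K(1))
    then have "exp (- (norm x)\<^sup>2 / 2) * exp (- K * t) \<le> exp (- (norm (x + t *\<^sub>R b))\<^sup>2 / 2)"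
      by (simp flip: exp_add)
    then show "exp (- (norm x)\<^sup>2 / 2) * ((poly q t)\<^sup>2 * exp (- K * t)) \<le> g (x + t *\<^sub>R b)"
      unfolding g_def q(2) by (simp add: mult.left_commute mult_left_mono)
  qed (use cont in \<open>auto intro!: integrable_continuous_interval continuous_intros\<close>)
  finally have "ennreal (g x) \<le> ennreal ((K + real p + 3)\<^sup>2) * ennreal (integral {0..1} (\<lambda>t. g (x + t *\<^sub>R b)))"
    by (simp add: ennreal_leI flip: ennreal_mult')
  also have "ennreal (integral {0..1} (\<lambda>t. g (x + t *\<^sub>R b)))
     = (\<integral>\<^sup>+ t. ennreal (g (x + t *\<^sub>R b)) * indicator {0..1} t \<partial>lborel)"
    using int by (intro nn_integral_has_integral_lebesgue'[symmetric]) (simp add: g_def)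
  finally show ?thesis unfolding g_def .
qed

section \<open>Lebesgue measure in oblique coordinates\<close>

lemma nn_integral_lborel_plus:
  fixes f :: "'a::euclidean_space \<Rightarrow> ennreal"
  assumes [measurable]: "f \<in> borel_measurable borel"
  shows "(\<integral>\<^sup>+ x. f (c + x) \<partial>lborel) = (\<integral>\<^sup>+ x. f x \<partial>lborel)"
proof -
  have "(\<integral>\<^sup>+ x. f x \<partial>lborel) = (\<integral>\<^sup>+ x. f x \<partial>distr lborel borel ((+) c))"
    by (simp only: lborel_distr_plus)
  also have "\<dots> = (\<integral>\<^sup>+ x. f (c + x) \<partial>lborel)"
    by (subst nn_integral_distr) auto
  finally show ?thesis ..
qed

lemma nn_integral_lborel_minus:
  fixes f :: "'a::euclidean_space \<Rightarrow> ennreal"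
  assumes [measurable]: "f \<in> borel_measurable borel"
  shows "(\<integral>\<^sup>+ x. f (c - x) \<partial>lborel) = (\<integral>\<^sup>+ x. f x \<partial>lborel)"
proof -
  have "lborel = distr lborel borel (\<lambda>x. c - x)"
    using lborel_affine[of "-1" c] by (simp add: density_1)
  then have "(\<integral>\<^sup>+ x. f x \<partial>lborel) = (\<integral>\<^sup>+ x. f x \<partial>distr lborel borel (\<lambda>x. c - x))"
    by simp
  also have "\<dots> = (\<integral>\<^sup>+ x. f (c - x) \<partial>lborel)"
    by (subst nn_integral_distr) auto
  finally show ?thesis ..
qed

text \<open>
  The argument for the uniqueness of Haar measure, applied to \<open>lborel\<close> and its image under \<open>f\<close>;
  the unit ball, being invariant under \<open>f\<close>, shows that the constant is \<open>1\<close>.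
\<close>

lemma lborel_distr_orthogonal_transformation:
  fixes f :: "'a::euclidean_space \<Rightarrow> 'a"
  assumes f: "orthogonal_transformation f"
  shows "distr lborel borel f = lborel"
proof (rule measure_eqI)
  fix A assume "A \<in> sets (distr lborel borel f)"
  then have A [measurable]: "A \<in> sets borel" by simp
  have "linear f" using f by (rule orthogonal_transformation_linear)
  then have [measurable]: "f \<in> borel_measurable borel"
    by (intro borel_measurable_continuous_onI linear_continuous_on linear_conv_bounded_linear[THEN iffD1])
  define E where "E = ball (0::'a) 1"
  have E [measurable]: "E \<in> sets borel" by (simp add: E_def)
  have fE: "f x \<in> E \<longleftrightarrow> x \<in> E" for x
    using f by (simp add: E_def orthogonal_transformation)
  have surj: "surj f" using f by (rule orthogonal_transformation_surj)
  \<comment> \<open>By surjectivity \<open>x = f w\<close>, so that subtracting \<open>x\<close>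
    after \<open>f\<close> amounts to translating the argument of \<open>f\<close>, under which
    \<open>lborel\<close> is invariant.\<close>
  have inv: "(\<integral>\<^sup>+ y. h (f y - x) \<partial>lborel) = (\<integral>\<^sup>+ y. h (f y) \<partial>lborel)"
    if [measurable]: "h \<in> borel_measurable borel" for h :: "'a \<Rightarrow> ennreal" and x
  proof -
    obtain w where "x = f w" using surj by blast
    then have "h (f y - x) = h (f (- w + y))" for y
      using \<open>linear f\<close> by (simp add: linear_add linear_neg linear_diff)
    then show ?thesis
      by (simp only:) (rule nn_integral_lborel_plus, measurable)
  qed
  \<comment> \<open>The double integral of \<open>indicator A x * indicator E (f y - x)\<close> is
    evaluated in two ways. Integrating over \<open>y\<close> first gives the measure of
    \<open>A\<close> times that of \<open>E\<close>. Substituting \<open>x = f y - z\<close> and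
    then integrating over \<open>y\<close> gives the image measure of \<open>A\<close> times the
    measure of \<open>E\<close>.\<close>
  have "emeasure lborel A * emeasure lborel E = (\<integral>\<^sup>+ x. indicator A x * emeasure lborel E \<partial>lborel)"
    by (simp add: nn_integral_multc)
  also have "\<dots> = (\<integral>\<^sup>+ x. indicator A x * (\<integral>\<^sup>+ y. indicator E (f y - x) \<partial>lborel) \<partial>lborel)"
  proof (rule nn_integral_cong)
    fix x
    have "(\<integral>\<^sup>+ y. indicator E (f y - x) \<partial>lborel) = (\<integral>\<^sup>+ y. indicator E (f y) \<partial>lborel)"
      by (rule inv) measurable
    also have "\<dots> = (\<integral>\<^sup>+ y. indicator E y \<partial>lborel)"
      by (simp add: indicator_def fE)
    finally show "indicator A x * emeasure lborel E
        = indicator A x * (\<integral>\<^sup>+ y. indicator E (f y - x) \<partial>lborel)"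
      by simp
  qed
  also have "\<dots> = (\<integral>\<^sup>+ x. \<integral>\<^sup>+ y. indicator A x * indicator E (f y - x) \<partial>lborel \<partial>lborel)"
    by (simp add: nn_integral_cmult)
  also have "\<dots> = (\<integral>\<^sup>+ y. \<integral>\<^sup>+ x. indicator A x * indicator E (f y - x) \<partial>lborel \<partial>lborel)"
    by (rule lborel_pair.Fubini') measurable
  also have "\<dots> = (\<integral>\<^sup>+ y. \<integral>\<^sup>+ z. indicator A (f y - z) * indicator E z \<partial>lborel \<partial>lborel)"
  proof (rule nn_integral_cong)
    fix y
    have "(\<integral>\<^sup>+ z. indicator A (f y - z) * indicator E (f y - (f y - z)) \<partial>lborel)
        = (\<integral>\<^sup>+ x. indicator A x * indicator E (f y - x) \<partial>lborel)"
      by (rule nn_integral_lborel_minus[of "\<lambda>x. indicator A x * indicator E (f y - x)"]) measurable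
    then show "(\<integral>\<^sup>+ x. indicator A x * indicator E (f y - x) \<partial>lborel)
        = (\<integral>\<^sup>+ z. indicator A (f y - z) * indicator E z \<partial>lborel)"
      by simp
  qed
  also have "\<dots> = (\<integral>\<^sup>+ z. \<integral>\<^sup>+ y. indicator A (f y - z) * indicator E z \<partial>lborel \<partial>lborel)"
    by (rule lborel_pair.Fubini') measurable
  also have "\<dots> = (\<integral>\<^sup>+ z. emeasure (distr lborel borel f) A * indicator E z \<partial>lborel)"
  proof (rule nn_integral_cong)
    fix z
    have "(\<integral>\<^sup>+ y. indicator A (f y - z) * indicator E z \<partial>lborel)
        = (\<integral>\<^sup>+ y. indicator A (f y - z) \<partial>lborel) * indicator E z"
      by (rule nn_integral_multc) measurable
    also have "(\<integral>\<^sup>+ y. indicator A (f y - z) \<partial>lborel) = (\<integral>\<^sup>+ y. indicator A (f y) \<partial>lborel)"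
      by (rule inv) measurable
    also have "\<dots> = emeasure (distr lborel borel f) A"
      by (subst nn_integral_indicator[symmetric], simp, subst nn_integral_distr) auto
    finally show "(\<integral>\<^sup>+ y. indicator A (f y - z) * indicator E z \<partial>lborel)
        = emeasure (distr lborel borel f) A * indicator E z" .
  qed
  also have "\<dots> = emeasure (distr lborel borel f) A * emeasure lborel E"
    by (simp add: nn_integral_cmult)
  finally have "emeasure lborel A * emeasure lborel E
      = emeasure (distr lborel borel f) A * emeasure lborel E" .
  \<comment> \<open>The ball has positive finite measure, so its factor can be cancelled in
    \<open>ennreal\<close>.\<close>
  moreover have "emeasure lborel E \<noteq> 0"
    using open_not_negligible[of E] by (auto simp: E_def negligible_iff_emeasure0)
  moreover have "emeasure lborel E \<noteq> top"
    using emeasure_lborel_ball_finite[of "0::'a" 1] by (auto simp: E_def)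
  ultimately show "emeasure (distr lborel borel f) A = emeasure lborel A"
    by (auto simp: ennreal_mult_cancel_left mult.commute[of _ "emeasure lborel E"])
qed simp

section \<open>Product Lebesgue measure in orthonormal and oblique coordinates\<close>

lemma measurable_PiM_lincomb [measurable]:
  fixes B :: "'a::euclidean_space set"
  assumes "B \<subseteq> C" "finite B"
  shows "(\<lambda>f. \<Sum>u\<in>B. f u *\<^sub>R u) \<in> borel_measurable (Pi\<^sub>M C (\<lambda>_. lborel :: real measure))"
proof (intro borel_measurable_sum borel_measurable_scaleR borel_measurable_const)
  fix u assume "u \<in> B"
  then have "(\<lambda>f. f u) \<in> Pi\<^sub>M C (\<lambda>_. lborel :: real measure) \<rightarrow>\<^sub>M lborel"
    using assms by (intro measurable_component_singleton) auto
  then show "(\<lambda>f. f u) \<in> borel_measurable (Pi\<^sub>M C (\<lambda>_. lborel :: real measure))"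
    by simp
qed

lemma product_sigma_finite_lborel: "product_sigma_finite (\<lambda>_. lborel)"
  by unfold_locales

text \<open>The coordinate map factors as \<open>R \<circ> Q\<close>: \<open>Q\<close> uses the
  coordinates with respect to the standard basis, and \<open>R\<close> is the orthogonal map
  carrying that basis to \<open>B\<close> along a bijection. \<open>Q\<close> sends the product
  measure to \<open>lborel\<close>, because preimages of boxes are products of intervals, and
  \<open>R\<close> preserves \<open>lborel\<close>.\<close>

lemma distr_PiM_orthonormal_basis:
  fixes B :: "'a::euclidean_space set"
  assumes orth: "pairwise orthogonal B" and norm: "\<And>u. u \<in> B \<Longrightarrow> norm u = 1"
    and card: "card B = DIM('a)"
  shows "distr (Pi\<^sub>M B (\<lambda>_. lborel)) borel (\<lambda>f. \<Sum>u\<in>B. f u *\<^sub>R u) = lborel"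
proof -
  interpret product_sigma_finite "\<lambda>_::'a. lborel :: real measure"
    by (rule product_sigma_finite_lborel)
  have fin: "finite B" using card by (metis card.infinite DIM_positive less_irrefl)
  obtain \<phi> where \<phi>: "bij_betw \<phi> (Basis :: 'a set) B"
    using fin card finite_same_card_bij[of "Basis :: 'a set" B] by auto
  have \<phi>B: "\<phi> b \<in> B" if "b \<in> Basis" for b using \<phi> that by (auto simp: bij_betw_def)
  define R where "R = (\<lambda>x::'a. \<Sum>b\<in>Basis. (x \<bullet> b) *\<^sub>R \<phi> b)"
  define Q where "Q = (\<lambda>f. \<Sum>b\<in>(Basis::'a set). f (\<phi> b) *\<^sub>R b :: 'a)"
  have \<phi>inner: "\<phi> a \<bullet> \<phi> b = (if a = b then 1 else 0)" if "a \<in> Basis" "b \<in> Basis" for a b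
  proof (cases "a = b")
    case True
    then show ?thesis using norm[OF \<phi>B[OF that(1)]] by (simp add: norm_eq_1)
  next
    case False
    then have "\<phi> a \<noteq> \<phi> b" using \<phi> that by (auto simp: bij_betw_def inj_on_def)
    then show ?thesis using False orth \<phi>B that by (auto simp: pairwise_def orthogonal_def)
  qed
  have linR: "linear R"
    unfolding R_def
    by (intro linear_compose_sum ballI linearI) (auto simp: inner_simps scaleR_add_left)
  have "R x \<bullet> R y = x \<bullet> y" for x y
  proof -
    have "R x \<bullet> R y = (\<Sum>a\<in>Basis. \<Sum>b\<in>Basis. (x \<bullet> a) * (y \<bullet> b) * (\<phi> a \<bullet> \<phi> b))"
      by (simp add: R_def inner_sum_left inner_sum_right mult.assoc sum_distrib_left)
         (subst sum.swap, simp add: mult.left_commute)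
    also have "\<dots> = (\<Sum>a\<in>Basis. (x \<bullet> a) * (y \<bullet> a))"
      by (intro sum.cong refl) (simp add: \<phi>inner if_distrib sum.delta cong: if_cong sum.cong)
    finally show ?thesis by (simp add: euclidean_inner[of x y])
  qed
  then have R: "orthogonal_transformation R"
    using linR by (simp add: orthogonal_transformation_def)
  have R_Basis: "R b = \<phi> b" if "b \<in> Basis" for b
    unfolding R_def using that by (simp add: inner_Basis if_distrib if_distribR sum.delta' cong: if_cong)
  have RQ: "R (Q f) = (\<Sum>u\<in>B. f u *\<^sub>R u)" for f
  proof -
    have "R (Q f) = (\<Sum>b\<in>Basis. f (\<phi> b) *\<^sub>R \<phi> b)"
      by (simp add: Q_def linear_sum[OF linR] linear_cmul[OF linR] R_Basis)
    also have "\<dots> = (\<Sum>u\<in>B. f u *\<^sub>R u)"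
      by (rule sum.reindex_bij_betw[OF \<phi>])
    finally show ?thesis .
  qed
  have Qm [measurable]: "Q \<in> borel_measurable (Pi\<^sub>M B (\<lambda>_. lborel))"
    unfolding Q_def
  proof (intro borel_measurable_sum borel_measurable_scaleR borel_measurable_const)
    fix b :: 'a assume "b \<in> Basis"
    then have "(\<lambda>f. f (\<phi> b)) \<in> Pi\<^sub>M B (\<lambda>_. lborel :: real measure) \<rightarrow>\<^sub>M lborel"
      using \<phi>B by (intro measurable_component_singleton) auto
    then show "(\<lambda>f. f (\<phi> b)) \<in> borel_measurable (Pi\<^sub>M B (\<lambda>_. lborel :: real measure))"
      by simp
  qed
  have "lborel = distr (Pi\<^sub>M B (\<lambda>_. lborel)) borel Q"
  proof (rule lborel_eqI)
    fix l u :: 'a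
    assume lu: "\<And>b. b \<in> Basis \<Longrightarrow> l \<bullet> b \<le> u \<bullet> b"
    define \<psi> where "\<psi> = inv_into Basis \<phi>"
    have \<psi>\<phi>: "\<psi> (\<phi> b) = b" if "b \<in> Basis" for b
      using \<phi> that by (simp add: \<psi>_def bij_betw_def)
    have Qb: "Q f \<bullet> b = f (\<phi> b)" if "b \<in> Basis" for f b
      using that by (simp add: Q_def inner_sum_left inner_Basis if_distrib sum.delta' cong: if_cong)
    have B: "B = \<phi> ` Basis" using \<phi> by (auto simp: bij_betw_def)
    have "Q -` box l u \<inter> space (Pi\<^sub>M B (\<lambda>_. lborel)) = Pi\<^sub>E B (\<lambda>w. {l \<bullet> \<psi> w<..<u \<bullet> \<psi> w})"
      by (auto simp: space_PiM PiE_iff box_def Qb B \<psi>\<phi>)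
    then have "emeasure (distr (Pi\<^sub>M B (\<lambda>_. lborel)) borel Q) (box l u)
        = (\<Prod>w\<in>B. emeasure lborel {l \<bullet> \<psi> w<..<u \<bullet> \<psi> w})"
      using fin by (simp add: emeasure_distr emeasure_PiM)
    also have "\<dots> = (\<Prod>b\<in>Basis. emeasure lborel {l \<bullet> b<..<u \<bullet> b})"
      by (subst prod.reindex_bij_betw[OF \<phi>, symmetric]) (simp add: \<psi>\<phi>)
    also have "\<dots> = (\<Prod>b\<in>Basis. ennreal ((u - l) \<bullet> b))"
      using lu by (simp add: inner_diff_left)
    also have "\<dots> = ennreal (\<Prod>b\<in>Basis. (u - l) \<bullet> b)"
      using lu by (intro prod_ennreal) (simp add: inner_diff_left)
    finally show "emeasure (distr (Pi\<^sub>M B (\<lambda>_. lborel)) borel Q) (box l u) = (\<Prod>b\<in>Basis. (u - l) \<bullet> b)" .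
  qed simp
  then have "lborel = distr (distr (Pi\<^sub>M B (\<lambda>_. lborel)) borel Q) borel R"
    using lborel_distr_orthogonal_transformation[OF R] by simp
  also have "\<dots> = distr (Pi\<^sub>M B (\<lambda>_. lborel)) borel (R \<circ> Q)"
    using linR
    by (intro distr_distr)
       (auto intro!: borel_measurable_continuous_onI linear_continuous_on linear_conv_bounded_linear[THEN iffD1])
  also have "R \<circ> Q = (\<lambda>f. \<Sum>u\<in>B. f u *\<^sub>R u)"
    by (simp add: fun_eq_iff RQ)
  finally show ?thesis ..
qed

text \<open>The image of the product measure under the shift agrees with it on rectangles, by
  translation invariance in each coordinate. The shifted point is restricted to \<open>B\<close>
  because points of the product space are extensional.\<close>

lemma nn_integral_PiM_lborel_translate:
  fixes c :: "'i \<Rightarrow> real"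
  assumes fin: "finite B" and h [measurable]: "h \<in> borel_measurable (Pi\<^sub>M B (\<lambda>_. lborel))"
  shows "(\<integral>\<^sup>+ f. h (\<lambda>u\<in>B. f u + c u) \<partial>Pi\<^sub>M B (\<lambda>_. lborel)) = (\<integral>\<^sup>+ f. h f \<partial>Pi\<^sub>M B (\<lambda>_. lborel))"
proof -
  interpret product_sigma_finite "\<lambda>_::'i. lborel :: real measure"
    by (rule product_sigma_finite_lborel)
  define \<tau> where "\<tau> = (\<lambda>f. \<lambda>u\<in>B. f u + c u)"
  have \<tau> [measurable]: "\<tau> \<in> Pi\<^sub>M B (\<lambda>_. lborel) \<rightarrow>\<^sub>M Pi\<^sub>M B (\<lambda>_. lborel)"
    unfolding \<tau>_def by measurable
  have "distr (Pi\<^sub>M B (\<lambda>_. lborel)) (Pi\<^sub>M B (\<lambda>_. lborel)) \<tau> = Pi\<^sub>M B (\<lambda>_. lborel)"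
  proof (rule PiM_eqI[OF fin])
    fix A :: "'i \<Rightarrow> real set"
    assume A: "\<And>i. i \<in> B \<Longrightarrow> A i \<in> sets lborel"
    have m: "((+) (c i)) -` A i \<in> sets borel" if "i \<in> B" for i
      using A[OF that] measurable_sets_borel[of "(+) (c i)" borel "A i"] by simp
    have "\<tau> -` Pi\<^sub>E B A \<inter> space (Pi\<^sub>M B (\<lambda>_. lborel)) = Pi\<^sub>E B (\<lambda>i. ((+) (c i)) -` A i)"
      by (auto simp: space_PiM PiE_iff \<tau>_def add.commute)
    then have "emeasure (distr (Pi\<^sub>M B (\<lambda>_. lborel)) (Pi\<^sub>M B (\<lambda>_. lborel)) \<tau>) (Pi\<^sub>E B A)
        = emeasure (Pi\<^sub>M B (\<lambda>_. lborel)) (Pi\<^sub>E B (\<lambda>i. ((+) (c i)) -` A i))"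
      using A fin by (subst emeasure_distr) (auto intro!: sets_PiM_I_finite)
    also have "\<dots> = (\<Prod>i\<in>B. emeasure lborel (((+) (c i)) -` A i))"
      using m fin by (intro emeasure_PiM) auto
    also have "\<dots> = (\<Prod>i\<in>B. emeasure lborel (A i))"
    proof (rule prod.cong[OF refl])
      fix i assume "i \<in> B"
      have "emeasure lborel (A i) = emeasure (distr lborel borel ((+) (c i))) (A i)"
        by (simp only: lborel_distr_plus)
      also have "\<dots> = emeasure lborel (((+) (c i)) -` A i)"
        using A[OF \<open>i \<in> B\<close>] by (subst emeasure_distr) auto
      finally show "emeasure lborel (((+) (c i)) -` A i) = emeasure lborel (A i)" ..
    qed
    finally show "emeasure (distr (Pi\<^sub>M B (\<lambda>_. lborel)) (Pi\<^sub>M B (\<lambda>_. lborel)) \<tau>) (Pi\<^sub>E B A)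
       = (\<Prod>i\<in>B. emeasure lborel (A i))" .
  qed simp
  then have "(\<integral>\<^sup>+ f. h f \<partial>Pi\<^sub>M B (\<lambda>_. lborel))
      = (\<integral>\<^sup>+ f. h f \<partial>distr (Pi\<^sub>M B (\<lambda>_. lborel)) (Pi\<^sub>M B (\<lambda>_. lborel)) \<tau>)"
    by simp
  also have "\<dots> = (\<integral>\<^sup>+ f. h (\<tau> f) \<partial>Pi\<^sub>M B (\<lambda>_. lborel))"
    by (rule nn_integral_distr) measurable
  finally show ?thesis by (simp add: \<tau>_def)
qed

text \<open>The axis \<open>b\<close> splits into \<open>(n \<bullet> b) n\<close> and a part in the
  span of \<open>B\<close>. Rescaling the coordinate along \<open>n\<close> produces the Jacobian
  \<open>|n \<bullet> b|\<close>. The tangential part is a shear: for fixed \<open>t\<close> it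
  merely translates the coordinates along \<open>B\<close>.\<close>

lemma nn_integral_oblique_coordinates:
  fixes B :: "'a::euclidean_space set"
  assumes orth: "pairwise orthogonal (insert n B)"
    and norm: "\<And>u. u \<in> insert n B \<Longrightarrow> norm u = 1"
    and n: "n \<notin> B" and card: "card (insert n B) = DIM('a)"
    and b: "n \<bullet> b \<noteq> 0"
    and g [measurable]: "g \<in> borel_measurable borel"
  shows "ennreal \<bar>n \<bullet> b\<bar> *
      (\<integral>\<^sup>+ f. (\<integral>\<^sup>+ t. g (a + (\<Sum>u\<in>B. f u *\<^sub>R u) + t *\<^sub>R b) \<partial>lborel) \<partial>Pi\<^sub>M B (\<lambda>_. lborel))
    = (\<integral>\<^sup>+ x. g x \<partial>lborel)"
proof -
  interpret product_sigma_finite "\<lambda>_::'a. lborel :: real measure"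
    by (rule product_sigma_finite_lborel)
  have "finite (insert n B)" using card by (metis card.infinite DIM_positive less_irrefl)
  then have fin: "finite B" by simp
  interpret P: sigma_finite_measure "Pi\<^sub>M B (\<lambda>_::'a. lborel :: real measure)"
    by (rule sigma_finite[OF fin])
  interpret PP: pair_sigma_finite "Pi\<^sub>M B (\<lambda>_::'a. lborel :: real measure)" "lborel :: real measure"
    by unfold_locales
  have ind: "independent (insert n B)"
    using orth norm by (intro pairwise_orthogonal_independent) (metis norm_zero zero_neq_one)+
  have "UNIV \<subseteq> span (insert n B)"
    using ind card \<open>finite (insert n B)\<close> by (intro card_ge_dim_independent) auto
  then have "(\<Sum>u\<in>insert n B. (b \<bullet> u) *\<^sub>R u) = b"
    using orth norm \<open>finite (insert n B)\<close> by (intro orthonormal_basis_expand) auto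
  then have exp: "(\<Sum>u\<in>B. (b \<bullet> u) *\<^sub>R u) + (n \<bullet> b) *\<^sub>R n = b"
    using fin n by (simp add: inner_commute add.commute)
  have S [measurable]: "(\<lambda>f. \<Sum>u\<in>B. f u *\<^sub>R u) \<in> borel_measurable (Pi\<^sub>M B (\<lambda>_. lborel))"
    using fin by (intro measurable_PiM_lincomb) auto
  have "(\<integral>\<^sup>+ x. g x \<partial>lborel) = (\<integral>\<^sup>+ x. g (a + x) \<partial>lborel)"
    by (rule nn_integral_lborel_plus[OF g, symmetric])
  also have "\<dots> = (\<integral>\<^sup>+ x. g (a + x) \<partial>distr (Pi\<^sub>M (insert n B) (\<lambda>_. lborel)) borel (\<lambda>f. \<Sum>u\<in>insert n B. f u *\<^sub>R u))"
    using distr_PiM_orthonormal_basis[OF orth norm card] by simp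
  also have "\<dots> = (\<integral>\<^sup>+ f. g (a + (\<Sum>u\<in>insert n B. f u *\<^sub>R u)) \<partial>Pi\<^sub>M (insert n B) (\<lambda>_. lborel))"
    using fin by (intro nn_integral_distr measurable_PiM_lincomb) auto
  \<comment> \<open>The coordinate along \<open>n\<close> becomes the outer variable, so that the
    shear is a translation of the inner integral; the order is exchanged only at the end.\<close>
  also have "\<dots> = (\<integral>\<^sup>+ t. (\<integral>\<^sup>+ f. g (a + (\<Sum>u\<in>insert n B. (f(n := t)) u *\<^sub>R u)) \<partial>Pi\<^sub>M B (\<lambda>_. lborel)) \<partial>lborel)"
  proof (rule product_nn_integral_insert_rev[OF fin n])
    have [measurable]: "(\<lambda>f. \<Sum>u\<in>insert n B. f u *\<^sub>R u) \<in> borel_measurable (Pi\<^sub>M (insert n B) (\<lambda>_. lborel))"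
      using fin by (intro measurable_PiM_lincomb) auto
    show "(\<lambda>f. g (a + (\<Sum>u\<in>insert n B. f u *\<^sub>R u))) \<in> borel_measurable (Pi\<^sub>M (insert n B) (\<lambda>_. lborel))"
      by measurable
  qed
  also have "\<dots> = (\<integral>\<^sup>+ t. (\<integral>\<^sup>+ f. g (a + (\<Sum>u\<in>B. f u *\<^sub>R u) + t *\<^sub>R n) \<partial>Pi\<^sub>M B (\<lambda>_. lborel)) \<partial>lborel)"
  proof -
    have "(\<Sum>u\<in>insert n B. (f(n := t)) u *\<^sub>R u) = (\<Sum>u\<in>B. f u *\<^sub>R u) + t *\<^sub>R n" for f and t :: real
      using fin n by (simp add: add.commute) (intro arg_cong2[where f = "(+)"] sum.cong refl, auto)
    then show ?thesis by (simp only: add.assoc)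
  qed
  also have "\<dots> = ennreal \<bar>n \<bullet> b\<bar> *
      (\<integral>\<^sup>+ t. (\<integral>\<^sup>+ f. g (a + (\<Sum>u\<in>B. f u *\<^sub>R u) + (0 + (n \<bullet> b) * t) *\<^sub>R n) \<partial>Pi\<^sub>M B (\<lambda>_. lborel)) \<partial>lborel)"
    using b by (intro nn_integral_real_affine) measurable
  also have "\<dots> = ennreal \<bar>n \<bullet> b\<bar> *
      (\<integral>\<^sup>+ t. (\<integral>\<^sup>+ f. g (a + (\<Sum>u\<in>B. f u *\<^sub>R u) + t *\<^sub>R b) \<partial>Pi\<^sub>M B (\<lambda>_. lborel)) \<partial>lborel)"
  proof (rule arg_cong[where f = "\<lambda>x. ennreal \<bar>n \<bullet> b\<bar> * x"], rule nn_integral_cong)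
    fix t :: real
    define h where "h = (\<lambda>f. g (a + (\<Sum>u\<in>B. f u *\<^sub>R u) + (0 + (n \<bullet> b) * t) *\<^sub>R n))"
    have [measurable]: "h \<in> borel_measurable (Pi\<^sub>M B (\<lambda>_. lborel))"
      unfolding h_def by measurable
    have "h (\<lambda>u\<in>B. f u + t * (b \<bullet> u)) = g (a + (\<Sum>u\<in>B. f u *\<^sub>R u) + t *\<^sub>R b)" for f
    proof -
      have "(\<Sum>u\<in>B. (\<lambda>u\<in>B. f u + t * (b \<bullet> u)) u *\<^sub>R u) = (\<Sum>u\<in>B. f u *\<^sub>R u) + t *\<^sub>R (\<Sum>u\<in>B. (b \<bullet> u) *\<^sub>R u)"
        by (simp add: scaleR_add_left sum.distrib scaleR_sum_right)
      also have "(\<Sum>u\<in>B. (b \<bullet> u) *\<^sub>R u) = b - (n \<bullet> b) *\<^sub>R n"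
        using exp by (simp add: algebra_simps)
      finally show ?thesis
        unfolding h_def by (simp add: algebra_simps)
    qed
    then have "(\<integral>\<^sup>+ f. h f \<partial>Pi\<^sub>M B (\<lambda>_. lborel))
        = (\<integral>\<^sup>+ f. g (a + (\<Sum>u\<in>B. f u *\<^sub>R u) + t *\<^sub>R b) \<partial>Pi\<^sub>M B (\<lambda>_. lborel))"
      using nn_integral_PiM_lborel_translate[OF fin, of h "\<lambda>u. t * (b \<bullet> u)"] by simp
    then show "(\<integral>\<^sup>+ f. g (a + (\<Sum>u\<in>B. f u *\<^sub>R u) + (0 + (n \<bullet> b) * t) *\<^sub>R n) \<partial>Pi\<^sub>M B (\<lambda>_. lborel))
        = (\<integral>\<^sup>+ f. g (a + (\<Sum>u\<in>B. f u *\<^sub>R u) + t *\<^sub>R b) \<partial>Pi\<^sub>M B (\<lambda>_. lborel))"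
      unfolding h_def .
  qed
  also have "(\<integral>\<^sup>+ t. (\<integral>\<^sup>+ f. g (a + (\<Sum>u\<in>B. f u *\<^sub>R u) + t *\<^sub>R b) \<partial>Pi\<^sub>M B (\<lambda>_. lborel)) \<partial>lborel)
      = (\<integral>\<^sup>+ f. (\<integral>\<^sup>+ t. g (a + (\<Sum>u\<in>B. f u *\<^sub>R u) + t *\<^sub>R b) \<partial>lborel) \<partial>Pi\<^sub>M B (\<lambda>_. lborel))"
    by (rule PP.Fubini') measurable
  finally show ?thesis ..
qed

section \<open>Lebesgue measure on flats\<close>

lemma dim_direction:
  assumes "S \<noteq> {}"
  shows "int (dim (direction S)) = aff_dim S"
proof -
  obtain x0 where x0: "x0 \<in> S" using assms by auto
  define D where "D = {x - y | x y. x \<in> S \<and> y \<in> S}"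
  define D0 where "D0 = (\<lambda>x. x - x0) ` S"
  have "D \<subseteq> span D0"
  proof
    fix z assume "z \<in> D"
    then obtain x y where "z = x - y" and xy: "x \<in> S" "y \<in> S" by (auto simp: D_def)
    then have "z = (x - x0) - (y - x0)" by simp
    also have "\<dots> \<in> span D0" using xy by (intro span_diff span_base) (auto simp: D0_def)
    finally show "z \<in> span D0" .
  qed
  moreover have "D0 \<subseteq> D" using x0 by (auto simp: D_def D0_def)
  ultimately have "span D = span D0"
    by (metis span_mono span_span subset_antisym)
  then have "dim (direction S) = dim D0"
    by (simp add: direction_def D_def[symmetric])
  then show ?thesis
    using aff_dim_eq_dim_subtract[OF hull_inc[OF x0]] by (simp add: D0_def)
qed

lemma direction_subset_hyperplane:
  assumes "S \<subseteq> {x. n \<bullet> x = c}"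
  shows "direction S \<subseteq> {x. n \<bullet> x = 0}"
  unfolding direction_def
proof (rule span_minimal)
  show "subspace {x. n \<bullet> x = 0}" by (rule subspace_hyperplane)
  show "{x - y |x y. x \<in> S \<and> y \<in> S} \<subseteq> {x. n \<bullet> x = 0}"
    using subsetD[OF assms] by (fastforce simp: inner_diff_right)
qed

text \<open>Replaces the choice operators in \<open>flat_measure\<close> by properties of the chosen
  objects. The choice of a basis is proper because every subspace has an orthonormal one.\<close>

lemma flat_measure_coordinates:
  fixes F :: "(real^'n) set"
  assumes "F \<noteq> {}"
  obtains a B where "pairwise orthogonal B" "\<And>u. u \<in> B \<Longrightarrow> norm u = 1" "finite B"
    "B \<subseteq> direction F" "int (card B) = aff_dim F"
    "flat_measure F = distr (Pi\<^sub>M B (\<lambda>_. lborel)) borel (\<lambda>f. a + (\<Sum>u\<in>B. f u *\<^sub>R u))"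
proof -
  define B where "B = (SOME B. pairwise orthogonal B \<and> (\<forall>u\<in>B. norm u = 1) \<and> span B = direction F)"
  have "subspace (direction F)" by (simp add: direction_def)
  then have "\<exists>B. pairwise orthogonal B \<and> (\<forall>u\<in>B. norm u = 1) \<and> span B = direction F"
    by (metis orthonormal_basis_subspace)
  then have "pairwise orthogonal B \<and> (\<forall>u\<in>B. norm u = 1) \<and> span B = direction F"
    unfolding B_def by (rule someI_ex)
  then have B: "pairwise orthogonal B" "\<And>u. u \<in> B \<Longrightarrow> norm u = 1" "span B = direction F"
    by auto
  have ind: "independent B"
    using B(1,2) by (intro pairwise_orthogonal_independent) (metis norm_zero zero_neq_one)+
  have "dim (direction F) = card B"
    using dim_span_eq_card_independent[OF ind] B(3) by simp
  then have "int (card B) = aff_dim F"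
    using dim_direction[OF assms] by simp
  moreover have "B \<subseteq> direction F" using B(3) span_superset by blast
  moreover have "finite B" using ind by (rule independent_imp_finite)
  moreover have "flat_measure F = distr (Pi\<^sub>M B (\<lambda>_. lborel)) borel
      (\<lambda>f. (SOME a. a \<in> F) + (\<Sum>u\<in>B. f u *\<^sub>R u))"
    by (simp add: flat_measure_def Let_def B_def)
  ultimately show ?thesis using B that by blast
qed

lemma sets_flat_measure [measurable_cong, simp]: "sets (flat_measure F) = sets borel"
  by (simp add: flat_measure_def Let_def)

text \<open>Since \<open>F\<close> has dimension \<open>d - 1\<close> and lies in a hyperplane with
  unit normal \<open>n\<close>, adding \<open>n\<close> to an orthonormal basis of its direction
  gives one of the whole space. The flat measure covers the entire hyperplane, so the lines parallel
  to \<open>b\<close> sweep out all of space.\<close>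

lemma nn_integral_flat_measure_oblique:
  fixes F :: "(real^'n) set"
  assumes F: "aff_dim F = int CARD('n) - 1" "F \<noteq> {}" "F \<subseteq> {x. n \<bullet> x = c}"
    and n: "norm n = 1" and b: "n \<bullet> b \<noteq> 0"
    and g [measurable]: "g \<in> borel_measurable borel"
  shows "ennreal \<bar>n \<bullet> b\<bar> * (\<integral>\<^sup>+ s. (\<integral>\<^sup>+ t. g (s + t *\<^sub>R b) \<partial>lborel) \<partial>flat_measure F)
    = (\<integral>\<^sup>+ x. g x \<partial>lborel)"
proof -
  obtain a B where B: "pairwise orthogonal B" "\<And>u. u \<in> B \<Longrightarrow> norm u = 1" "finite B"
    "B \<subseteq> direction F" "int (card B) = aff_dim F"
    and flat: "flat_measure F = distr (Pi\<^sub>M B (\<lambda>_. lborel)) borel (\<lambda>f. a + (\<Sum>u\<in>B. f u *\<^sub>R u))"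
    by (rule flat_measure_coordinates[OF F(2)]) (rule that, assumption+)
  have nB: "n \<bullet> u = 0" if "u \<in> B" for u
    using B(4) direction_subset_hyperplane[OF F(3)] that by auto
  then have "n \<notin> B" using n by (auto simp: norm_eq_1)
  then have card: "card (insert n B) = DIM(real^'n)"
    using B(3,5) F(1) by simp
  have orth: "pairwise orthogonal (insert n B)"
    using B(1) nB by (auto simp: pairwise_insert orthogonal_def inner_commute)
  have [measurable]: "(\<lambda>f. a + (\<Sum>u\<in>B. f u *\<^sub>R u)) \<in> borel_measurable (Pi\<^sub>M B (\<lambda>_. lborel))"
    using B(3) by (intro borel_measurable_add borel_measurable_const measurable_PiM_lincomb) auto
  have "(\<integral>\<^sup>+ s. (\<integral>\<^sup>+ t. g (s + t *\<^sub>R b) \<partial>lborel) \<partial>flat_measure F) =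
      (\<integral>\<^sup>+ f. (\<integral>\<^sup>+ t. g (a + (\<Sum>u\<in>B. f u *\<^sub>R u) + t *\<^sub>R b) \<partial>lborel) \<partial>Pi\<^sub>M B (\<lambda>_. lborel))"
    unfolding flat by (rule nn_integral_distr) measurable
  then show ?thesis
    using nn_integral_oblique_coordinates[OF orth _ \<open>n \<notin> B\<close> card b g, of a] B(2) n by fastforce
qed

section \<open>Geometry of elements and prisms\<close>

lemma infdist_ge_hyperplane:
  assumes "S \<subseteq> {x. n \<bullet> x = c}" "S \<noteq> {}" "norm n = 1"
  shows "\<bar>n \<bullet> y - c\<bar> \<le> infdist y S"
  unfolding infdist_notempty[OF assms(2)]
proof (rule cINF_greatest[OF assms(2)])
  fix x assume "x \<in> S"
  then have "n \<bullet> y - c = n \<bullet> (y - x)" using assms(1) by (auto simp: inner_diff_right)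
  then show "\<bar>n \<bullet> y - c\<bar> \<le> dist y x"
    using Cauchy_Schwarz_ineq2[of n "y - x"] assms(3) by (simp add: dist_norm)
qed

lemma infdist_hyperplane:
  assumes "norm n = 1"
  shows "infdist y {x. n \<bullet> x = c} = \<bar>n \<bullet> y - c\<bar>"
proof (rule antisym)
  define x where "x = y - (n \<bullet> y - c) *\<^sub>R n"
  have x: "x \<in> {x. n \<bullet> x = c}"
    using assms by (simp add: x_def inner_diff_right norm_eq_1)
  have "dist y x = \<bar>n \<bullet> y - c\<bar>"
    using assms by (simp add: x_def dist_norm)
  then show "infdist y {x. n \<bullet> x = c} \<le> \<bar>n \<bullet> y - c\<bar>"
    using infdist_le[OF x, of y] by simp
  show "\<bar>n \<bullet> y - c\<bar> \<le> infdist y {x. n \<bullet> x = c}"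
    using x assms by (intro infdist_ge_hyperplane) auto
qed

lemma affine_hull_eq_hyperplane:
  fixes F :: "(real^'n) set"
  assumes "aff_dim F = int CARD('n) - 1" "F \<noteq> {}" "F \<subseteq> {x. n \<bullet> x = c}" "n \<noteq> 0"
  shows "affine hull F = {x. n \<bullet> x = c}"
proof (rule affine_dim_equal)
  show "affine hull F \<subseteq> {x. n \<bullet> x = c}"
    using assms(3) by (intro hull_minimal) (auto simp: affine_hyperplane)
qed (use assms in \<open>auto simp: affine_hyperplane aff_dim_hyperplane\<close>)

lemma element_polytope:
  fixes T :: "(real^'n) set"
  assumes "simplicial_element T \<or> box_element T"
  shows "polytope T" "aff_dim T = int CARD('n)"
proof -
  have "polytope T \<and> aff_dim T = int CARD('n)"
    using assms
  proof
    assume "simplicial_element T"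
    then show ?thesis
      using simplex_imp_polytope aff_dim_simplex unfolding simplicial_element_def by blast
  next
    assume "box_element T"
    then obtain A :: "real^'n^'n" and a where A: "invertible A" "T = (\<lambda>x. a + A *v x) ` cbox 0 One"
      by (auto simp: box_element_def)
    have T: "T = (+) a ` ((*v) A ` cbox 0 One)"
      by (simp add: A(2) image_image)
    have "interior (cbox 0 One :: (real^'n) set) \<noteq> {}"
      by (simp add: box_eq_empty)
    then have "aff_dim (cbox 0 One :: (real^'n) set) = int CARD('n)"
      using aff_dim_nonempty_interior by fastforce
    moreover have "inj ((*v) A)" using A(1) by (metis inj_matrix_vector_mult)
    ultimately have "aff_dim T = int CARD('n)"
      unfolding T by (simp add: aff_dim_translation_eq aff_dim_injective_linear_image)
    moreover have "polytope T"
      unfolding T polytope_translation_eq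
      by (intro polytope_linear_image matrix_vector_mul_linear polytope_interval)
    ultimately show ?thesis by simp
  qed
  then show "polytope T" "aff_dim T = int CARD('n)" by auto
qed

section \<open>Facets, inradius and heights of prisms\<close>

lemma facet_outer_normal:
  assumes "polytope T" "F facet_of T"
  obtains n where "outer_normal T F n"
proof -
  have "F exposed_face_of T"
    using assms by (metis exposed_face_of_polyhedron facet_of_imp_face_of polytope_imp_polyhedron)
  then obtain a c where ac: "T \<subseteq> {x. a \<bullet> x \<le> c}" "F = T \<inter> {x. a \<bullet> x = c}"
    by (auto simp: exposed_face_of_def)
  have "F \<noteq> T" "F \<noteq> {}" using assms(2) by (auto simp: facet_of_def)
  \<comment> \<open>For \<open>a = 0\<close> the hyperplane would be empty or everything, making
    \<open>F\<close> empty or equal to \<open>T\<close>.\<close>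
  then have "a \<noteq> 0" using ac by auto
  then have "outer_normal T F (a /\<^sub>R norm a)"
    unfolding outer_normal_def using ac
    by (intro conjI exI[of _ "c / norm a"]) (auto simp: field_simps)
  then show ?thesis by (rule that)
qed

lemma cball_subset_halfspace_imp_le:
  assumes "cball x r \<subseteq> T" "0 < r" "norm n = 1" "T \<subseteq> {x. n \<bullet> x \<le> c}"
  shows "x - r *\<^sub>R n \<in> T" "2 * r \<le> c - n \<bullet> (x - r *\<^sub>R n)"
proof -
  have "x + r *\<^sub>R n \<in> T" "x - r *\<^sub>R n \<in> T"
    using assms(1-3) by (auto simp: subset_eq dist_norm)
  moreover have "n \<bullet> n = 1" using assms(3) by (simp add: norm_eq_1)
  ultimately show "x - r *\<^sub>R n \<in> T" "2 * r \<le> c - n \<bullet> (x - r *\<^sub>R n)"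
    using assms(4) by (auto simp: inner_simps)
qed

text \<open>A ball of radius \<open>r\<close> in \<open>T\<close> has width \<open>2 r\<close> in
  direction \<open>n\<close>, while no point of \<open>T\<close> is deeper than \<open>2 H\<close>
  below the hyperplane. The nonempty interior supplies one such radius, so the supremum is over a
  nonempty bounded set.\<close>

lemma inradius_le_half_width:
  assumes "interior T \<noteq> {}" "norm n = 1" "T \<subseteq> {x. n \<bullet> x \<le> c}"
    and "\<And>z. z \<in> T \<Longrightarrow> c - n \<bullet> z \<le> 2 * H"
  shows "0 < inradius T" "inradius T \<le> H"
proof -
  let ?R = "{r. 0 < r \<and> (\<exists>x. cball x r \<subseteq> T)}"
  have le: "r \<le> H" if "r \<in> ?R" for r
    using that cball_subset_halfspace_imp_le[of _ r T n c] assms by force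
  obtain x r where "0 < r" "cball x r \<subseteq> T"
    using assms(1) mem_interior_cball[of _ T] by auto
  then have r: "r \<in> ?R" by auto
  have "bdd_above ?R" using le by (intro bdd_aboveI)
  then have "r \<le> inradius T"
    unfolding inradius_def using r by (intro cSup_upper)
  then show "0 < inradius T" using \<open>0 < r\<close> by simp
  show "inradius T \<le> H"
    unfolding inradius_def using r le by (intro cSup_least) auto
qed

text \<open>Collects what simplicial and box prisms have in common. The factor \<open>2\<close> in
  the last claim is the half height of the section for a simplex; for a box the prism is as high as
  \<open>T\<close>, and the factor is slack.\<close>

lemma prism_family_geometry:
  fixes T F :: "(real^'n) set"
  assumes fam: "prism_family T F M G b" and facet: "F facet_of T"
    and normal: "norm n = 1" "T \<subseteq> {x. n \<bullet> x \<le> c}" "F = T \<inter> {x. n \<bullet> x = c}"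
  shows "F = (\<Union>i<M. G i)" (is ?cover)
    and "\<And>i. i < M \<Longrightarrow> closed (G i) \<and> G i \<noteq> {}"
    and "\<And>i x t. i < M \<Longrightarrow> x \<in> G i \<Longrightarrow> 0 \<le> t \<Longrightarrow> t \<le> 1 \<Longrightarrow> x + t *\<^sub>R b i \<in> T"
    and "\<And>i z. i < M \<Longrightarrow> z \<in> T \<Longrightarrow> c - n \<bullet> z \<le> 2 * \<bar>n \<bullet> b i\<bar>"
proof -
  have el: "simplicial_element T \<or> box_element T"
    using fam by (auto simp: prism_family_def)
  note poly = element_polytope(1)[OF el] and dim = element_polytope(2)[OF el]
  have F: "F \<noteq> {}" "aff_dim F = int CARD('n) - 1"
    using facet dim by (auto simp: facet_of_def)
  have Fpoly: "polytope F"
    using poly facet by (metis facet_of_imp_face_of face_of_polytope_polytope)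
  have hull: "affine hull F = {x. n \<bullet> x = c}"
    using F normal by (intro affine_hull_eq_hyperplane) auto
  have idist: "infdist z (affine hull F) = \<bar>n \<bullet> z - c\<bar>" for z
    unfolding hull by (rule infdist_hyperplane[OF normal(1)])
  have compT: "compact T" using poly by (rule polytope_imp_compact)
  have "?cover \<and> (\<forall>i<M. (closed (G i) \<and> G i \<noteq> {}) \<and>
      (\<forall>x t. x \<in> G i \<longrightarrow> 0 \<le> t \<longrightarrow> t \<le> 1 \<longrightarrow> x + t *\<^sub>R b i \<in> T) \<and>
      (\<forall>z\<in>T. c - n \<bullet> z \<le> 2 * \<bar>n \<bullet> b i\<bar>))"
    using fam unfolding prism_family_def
  proof
    assume "simplicial_element T \<and> simplicial_prisms T F M G b"
    then have S: "(\<Union>i<M. G i) = F"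
      "\<And>i. i < M \<Longrightarrow> polytope (G i)" "\<And>i. i < M \<Longrightarrow> aff_dim (G i) = int CARD('n) - 1"
      "\<And>i. i < M \<Longrightarrow> {x + t *\<^sub>R b i | x t. x \<in> G i \<and> 0 < t \<and> t < 1} \<subseteq> T"
      "\<And>i. i < M \<Longrightarrow> {x + b i | x. x \<in> G i} \<subseteq> half_height_section T F"
      by (auto simp: simplicial_prisms_def)
    show ?thesis
    proof (intro conjI allI impI ballI)
      show "F = (\<Union>i<M. G i)" using S(1) by simp
    next
      fix i assume i: "i < M"
      show "closed (G i)" using S(2)[OF i] by (simp add: polytope_imp_closed)
      \<comment> \<open>The dimension \<open>d - 1\<close> is nonnegative, whereas the empty set has
        \<open>aff_dim\<close> equal to \<open>-1\<close>.\<close>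
      show ne: "G i \<noteq> {}" using S(3)[OF i] by auto
      have GF: "G i \<subseteq> F" using S(1) i by auto
      have top: "x + b i \<in> half_height_section T F" if "x \<in> G i" for x
        using S(5)[OF i] that by blast
      show "x + t *\<^sub>R b i \<in> T" if "x \<in> G i" "0 \<le> t" "t \<le> 1" for x t
      proof -
        \<comment> \<open>The definition puts only the open prism in \<open>T\<close>; the lower
          base lies in \<open>F\<close> and the upper one in the half-height section, both subsets
          of \<open>T\<close>.\<close>
        have "t = 0 \<or> t = 1 \<or> 0 < t \<and> t < 1" using that by linarith
        then consider "t = 0" | "t = 1" | "0 < t" "t < 1" by blast
        then show ?thesis
        proof cases
          case 1
          then show ?thesis using that GF normal(3) by auto
        next
          case 2
          then show ?thesis using top[OF that(1)] by (auto simp: half_height_section_def)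
        next
          case 3
          then show ?thesis using S(4)[OF i] that by blast
        qed
      qed
      fix z assume z: "z \<in> T"
      obtain x where x: "x \<in> G i" using ne by auto
      then have xc: "n \<bullet> x = c" using GF normal(3) by auto
      have "\<bar>n \<bullet> (x + b i) - c\<bar> = (SUP z\<in>T. \<bar>n \<bullet> z - c\<bar>) / 2"
        using top[OF x] by (simp add: half_height_section_def idist)
      moreover have "\<bar>n \<bullet> z - c\<bar> \<le> (SUP z\<in>T. \<bar>n \<bullet> z - c\<bar>)"
      proof (rule cSUP_upper[OF z])
        have "compact ((\<lambda>z. \<bar>n \<bullet> z - c\<bar>) ` T)"
          using compT by (intro compact_continuous_image continuous_intros)
        then show "bdd_above ((\<lambda>z. \<bar>n \<bullet> z - c\<bar>) ` T)"
          by (intro bounded_imp_bdd_above compact_imp_bounded)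
      qed
      ultimately show "c - n \<bullet> z \<le> 2 * \<bar>n \<bullet> b i\<bar>"
        using xc by (simp add: inner_add_right)
    qed
  next
    assume "box_element T \<and> box_prism T F M G b"
    then have S: "M = 1" "G 0 = F" "T = {x + t *\<^sub>R b 0 | x t. x \<in> F \<and> 0 \<le> t \<and> t \<le> 1}"
      by (auto simp: box_prism_def)
    show ?thesis
    proof (intro conjI allI impI ballI)
      show "F = (\<Union>i<M. G i)" using S by (simp add: lessThan_Suc)
    next
      fix i assume "i < M"
      then have i: "i = 0" using S by simp
      show "closed (G i)" "G i \<noteq> {}" using Fpoly F S i by (auto simp: polytope_imp_closed)
      show "x + t *\<^sub>R b i \<in> T" if "x \<in> G i" "0 \<le> t" "t \<le> 1" for x t
        unfolding S(3) using that i S(2) by auto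
      fix z assume "z \<in> T"
      then obtain x t where z: "z = x + t *\<^sub>R b 0" "x \<in> F" "0 \<le> t" "t \<le> 1"
        using S(3) by auto
      then have "c - n \<bullet> z = - (t * (n \<bullet> b 0))"
        using normal(3) by (auto simp: inner_add_right)
      also have "\<dots> \<le> \<bar>t * (n \<bullet> b 0)\<bar>" by simp
      also have "\<dots> \<le> 1 * \<bar>n \<bullet> b 0\<bar>"
        unfolding abs_mult using z by (intro mult_right_mono) auto
      finally show "c - n \<bullet> z \<le> 2 * \<bar>n \<bullet> b i\<bar>" using i by simp
    qed
  qed
  then show ?cover
    and "\<And>i. i < M \<Longrightarrow> closed (G i) \<and> G i \<noteq> {}"
    and "\<And>i x t. i < M \<Longrightarrow> x \<in> G i \<Longrightarrow> 0 \<le> t \<Longrightarrow> t \<le> 1 \<Longrightarrow> x + t *\<^sub>R b i \<in> T"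
    and "\<And>i z. i < M \<Longrightarrow> z \<in> T \<Longrightarrow> c - n \<bullet> z \<le> 2 * \<bar>n \<bullet> b i\<bar>"
    by blast+
qed

section \<open>Finiteness of the angle sets and positivity of the sines\<close>

lemma sin_vector_angle_pos:
  assumes "u \<noteq> 0" "w \<noteq> 0"
    and "norm u *\<^sub>R w \<noteq> norm w *\<^sub>R u" "norm u *\<^sub>R w \<noteq> - norm w *\<^sub>R u"
  shows "0 < sin (vector_angle u w)"
proof -
  have "\<bar>u \<bullet> w\<bar> \<noteq> norm u * norm w"
    using assms norm_cauchy_schwarz_abs_eq[of u w] by auto
  then have "\<bar>u \<bullet> w\<bar> < norm u * norm w"
    using Cauchy_Schwarz_ineq2[of u w] by linarith
  define t where "t = u \<bullet> w / (norm u * norm w)"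
  have "\<bar>t\<bar> < 1"
    unfolding t_def using \<open>\<bar>u \<bullet> w\<bar> < norm u * norm w\<close>
    using assms(1,2) by (simp only: abs_divide abs_mult abs_norm_cancel) simp
  then have "0 < vector_angle u w" "vector_angle u w < pi"
    using arccos_lt_bounded[of t] by (auto simp: vector_angle_def t_def[symmetric])
  then show ?thesis by (rule sin_gt_zero)
qed

text \<open>An edge cannot be a proper initial part of a segment in \<open>T\<close>: its end
  \<open>z\<close> would lie strictly between \<open>x\<close> and \<open>y\<close>, so the face
  would contain \<open>y\<close>, which is farther from \<open>x\<close> than
  \<open>z\<close>.\<close>

lemma face_segment_not_shorter:
  fixes x y z :: "'a::euclidean_space"
  assumes "closed_segment x z face_of T" "x \<in> T" "y \<in> T" "0 < s" "s < 1" "y \<noteq> x"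
    and z: "z - x = s *\<^sub>R (y - x)"
  shows False
proof -
  have "z = (1 - s) *\<^sub>R x + s *\<^sub>R y" using z by (simp add: algebra_simps)
  then have "z \<in> open_segment x y"
    using assms by (auto simp: in_segment)
  moreover have "z \<in> closed_segment x z" by simp
  ultimately have "y \<in> closed_segment x z"
    using assms(1-3) unfolding face_of_def by blast
  then obtain r where r: "r \<le> 1" "y = (1 - r) *\<^sub>R x + r *\<^sub>R z"
    by (auto simp: in_segment)
  then have "y - x = r *\<^sub>R (z - x)" by (simp add: algebra_simps)
  then have "(1 - r * s) *\<^sub>R (y - x) = 0" using z by (simp add: algebra_simps)
  then have "r * s = 1" using \<open>y \<noteq> x\<close> by simp
  then show False
    using mult_right_mono[OF r(1), of s] assms(4,5) by simp
qed

text \<open>At angle \<open>0\<close> the shorter edge would be a proper part of the longer one; at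
  angle \<open>pi\<close> the vertex \<open>x\<close> would be inside the segment from
  \<open>y\<close> to \<open>z\<close>. Both contradict the defining property of faces.\<close>

lemma sin_edge_angle_pos:
  assumes "\<theta> \<in> edge_angles T"
  shows "0 < sin \<theta>"
proof -
  obtain x y z where \<theta>: "\<theta> = vector_angle (y - x) (z - x)"
    and e: "closed_segment x y edge_of T" "closed_segment x z edge_of T" and "y \<noteq> z"
    using assms by (auto simp: edge_angles_def)
  have f: "closed_segment x y face_of T" "closed_segment x z face_of T"
    using e by (auto simp: edge_of_def)
  have ne: "y \<noteq> x" "z \<noteq> x" using e by (auto simp: edge_of_def)
  have T: "x \<in> T" "y \<in> T" "z \<in> T"
    using f[THEN face_of_imp_subset] by auto
  define s where "s = norm (z - x) / norm (y - x)"
  have s: "0 < s" using ne by (simp add: s_def)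
  show ?thesis unfolding \<theta>
  proof (rule sin_vector_angle_pos)
    show "norm (y - x) *\<^sub>R (z - x) \<noteq> norm (z - x) *\<^sub>R (y - x)"
    proof
      assume "norm (y - x) *\<^sub>R (z - x) = norm (z - x) *\<^sub>R (y - x)"
      then have "inverse (norm (y - x)) *\<^sub>R norm (y - x) *\<^sub>R (z - x)
          = inverse (norm (y - x)) *\<^sub>R norm (z - x) *\<^sub>R (y - x)" by simp
      then have z: "z - x = s *\<^sub>R (y - x)"
        using ne by (simp add: s_def divide_inverse mult.commute)
      then have y: "y - x = (1 / s) *\<^sub>R (z - x)" using s by simp
      have "s \<noteq> 1" using z \<open>y \<noteq> z\<close> by auto
      then consider "s < 1" | "1 < s" by linarith
      then show False
      proof cases
        case 1
        then show False using face_segment_not_shorter[OF f(2) T(1,2) s _ ne(1) z] by simp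
      next
        case 2
        then show False using face_segment_not_shorter[OF f(1) T(1,3) _ _ ne(2) y] s by simp
      qed
    qed
    show "norm (y - x) *\<^sub>R (z - x) \<noteq> - norm (z - x) *\<^sub>R (y - x)"
    proof
      assume "norm (y - x) *\<^sub>R (z - x) = - norm (z - x) *\<^sub>R (y - x)"
      then have "inverse (norm (y - x)) *\<^sub>R norm (y - x) *\<^sub>R (z - x)
          = inverse (norm (y - x)) *\<^sub>R (- norm (z - x) *\<^sub>R (y - x))" by simp
      then have z: "z - x = - (s *\<^sub>R (y - x))"
        using ne by (simp add: s_def divide_inverse mult.commute)
      have "(1 + s) *\<^sub>R x = s *\<^sub>R y + z" using z by (simp add: algebra_simps)
      then have "inverse (1 + s) *\<^sub>R (1 + s) *\<^sub>R x = inverse (1 + s) *\<^sub>R (s *\<^sub>R y + z)" by simp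
      then have "x = inverse (1 + s) *\<^sub>R (s *\<^sub>R y + z)" using s by simp
      also have "\<dots> = (1 - inverse (1 + s)) *\<^sub>R y + inverse (1 + s) *\<^sub>R z"
      proof -
        have "1 - inverse (1 + s) = inverse (1 + s) * s" using s by (simp add: field_simps)
        then show ?thesis by (simp add: scaleR_add_right)
      qed
      finally have "x \<in> open_segment y z"
        using s \<open>y \<noteq> z\<close> unfolding in_segment by (intro conjI exI[of _ "inverse (1 + s)"]) (auto simp: field_simps)
      moreover have "x \<in> closed_segment x y" by simp
      \<comment> \<open>The face from \<open>x\<close> to \<open>y\<close> contains the inner point
        \<open>x\<close> of the segment from \<open>y\<close> to \<open>z\<close>, hence also
        \<open>z\<close>, although \<open>z\<close> lies on the opposite side of
        \<open>x\<close>.\<close>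
      ultimately have "z \<in> closed_segment x y"
        using f(1) T unfolding face_of_def by blast
      then obtain r where r: "0 \<le> r" "z = (1 - r) *\<^sub>R x + r *\<^sub>R y"
        by (auto simp: in_segment)
      then have "z - x = r *\<^sub>R (y - x)" by (simp add: algebra_simps)
      then have "(r + s) *\<^sub>R (y - x) = 0" using z by (metis scaleR_add_left left_minus)
      then show False using r s ne by auto
    qed
  qed (use ne in auto)
qed

text \<open>An edge angle is determined by three endpoints of edges; these are extreme points, of
  which a polytope has finitely many.\<close>

lemma finite_edge_angles:
  assumes "polytope T"
  shows "finite (edge_angles T)"
proof -
  let ?E = "{x. x extreme_point_of T}"
  have "finite ?E"
    using assms by (intro finite_polyhedron_extreme_points polytope_imp_polyhedron)
  moreover have "edge_angles T \<subseteq> (\<lambda>(x, y, z). vector_angle (y - x) (z - x)) ` (?E \<times> ?E \<times> ?E)"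
  proof
    fix \<theta> assume "\<theta> \<in> edge_angles T"
    then obtain x y z where \<theta>: "\<theta> = vector_angle (y - x) (z - x)"
      and e: "closed_segment x y face_of T" "closed_segment x z face_of T"
      by (auto simp: edge_angles_def edge_of_def)
    have "u extreme_point_of T" if "closed_segment x y face_of T" "u = x \<or> u = y" for x y u
      using that extreme_point_of_face[OF that(1), of u] extreme_point_of_segment[of u x y] by simp
    then show "\<theta> \<in> (\<lambda>(x, y, z). vector_angle (y - x) (z - x)) ` (?E \<times> ?E \<times> ?E)"
      using e \<theta> by force
  qed
  ultimately show ?thesis by (meson finite_SigmaI finite_imageI finite_subset)
qed

lemma outer_normal_le:
  assumes "outer_normal T F m" "x \<in> F" "y \<in> T"
  shows "m \<bullet> y \<le> m \<bullet> x"
  using assms by (auto simp: outer_normal_def)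

text \<open>Through a common point of the facets, equal normals give the same supporting hyperplane,
  hence \<open>F = G\<close>; opposite normals squeeze \<open>T\<close> into one hyperplane, hence
  \<open>F = T\<close>, which no facet satisfies.\<close>

lemma sin_dihedral_angle_pos:
  assumes "\<theta> \<in> dihedral_angles T"
  shows "0 < sin \<theta>"
proof -
  obtain m n F G where \<theta>: "\<theta> = pi - vector_angle m n"
    and F: "F facet_of T" "G facet_of T" "F \<noteq> G" "F \<inter> G \<noteq> {}"
    and m: "outer_normal T F m" and n: "outer_normal T G n"
    using assms unfolding dihedral_angles_def by blast
  have norm: "norm m = 1" "norm n = 1" using m n by (auto simp: outer_normal_def)
  obtain x where x: "x \<in> F" "x \<in> G" using F(4) by auto
  have FT: "F = T \<inter> {y. m \<bullet> y = m \<bullet> x}" and GT: "G = T \<inter> {y. n \<bullet> y = n \<bullet> x}"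
    using x m n by (auto simp: outer_normal_def)
  have "0 < sin (vector_angle m n)"
  proof (rule sin_vector_angle_pos)
    show "norm m *\<^sub>R n \<noteq> norm n *\<^sub>R m" using norm FT GT F(3) by auto
    show "norm m *\<^sub>R n \<noteq> - norm n *\<^sub>R m"
    proof
      assume "norm m *\<^sub>R n = - norm n *\<^sub>R m"
      then have "n = - m" using norm by simp
      then have "T \<subseteq> {y. m \<bullet> y = m \<bullet> x}"
        using outer_normal_le[OF m x(1)] outer_normal_le[OF n x(2)] by fastforce
      then have "F = T" using FT by auto
      then show False using F(1) by (simp add: facet_of_def)
    qed
  qed (use norm in auto)
  then show ?thesis by (simp add: \<theta>)
qed

text \<open>A facet spans a hyperplane, whose unit normal is determined up to sign; this is enough
  for finiteness.\<close>

lemma finite_outer_normals: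
  fixes T :: "(real^'n) set"
  assumes "aff_dim T = int CARD('n)" "F facet_of T"
  shows "finite {m. outer_normal T F m}"
proof (cases "\<exists>m. outer_normal T F m")
  case True
  have F: "aff_dim F = int CARD('n) - 1" "F \<noteq> {}"
    using assms by (auto simp: facet_of_def)
  have hull: "\<exists>c. affine hull F = {x. m \<bullet> x = c}" if "outer_normal T F m" for m
  proof -
    have "norm m = 1" "\<exists>c. F = T \<inter> {x. m \<bullet> x = c}"
      using that by (auto simp: outer_normal_def)
    then obtain c where c: "F = T \<inter> {x. m \<bullet> x = c}" by blast
    have "affine hull F = {x. m \<bullet> x = c}"
      using F c \<open>norm m = 1\<close> by (intro affine_hull_eq_hyperplane) auto
    then show ?thesis ..
  qed
  obtain m where m: "outer_normal T F m" using True by auto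
  have "m' = m \<or> m' = - m" if m': "outer_normal T F m'" for m'
  proof -
    obtain c c' where eq: "affine hull F = {x. m \<bullet> x = c}" "affine hull F = {x. m' \<bullet> x = c'}"
      using hull[OF m] hull[OF m'] by auto
    have norm: "m \<bullet> m = 1" "m' \<bullet> m' = 1" using m m' by (auto simp: outer_normal_def norm_eq_1)
    obtain x where "x \<in> F" using F(2) by auto
    then have x: "m \<bullet> x = c" "m' \<bullet> x = c'" using eq hull_inc[of x F affine] by auto
    \<comment> \<open>The component of \<open>m'\<close> orthogonal to \<open>m\<close>. Moving by
      \<open>z\<close> stays in the common hyperplane, so \<open>z\<close> is orthogonal to
      \<open>m'\<close> too, and therefore to itself.\<close>
    define z where "z = m' - (m \<bullet> m') *\<^sub>R m"
    have mz: "m \<bullet> z = 0" using norm by (simp add: z_def inner_diff_right)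
    then have "m \<bullet> (x + z) = c" using x by (simp add: inner_add_right)
    then have "m' \<bullet> (x + z) = c'" using eq by blast
    then have "m' \<bullet> z = 0" using x by (simp add: inner_add_right)
    then have "z \<bullet> z = 0"
      using mz by (subst (1) z_def) (simp add: inner_diff_left)
    then have m'eq: "m' = (m \<bullet> m') *\<^sub>R m" by (simp add: z_def)
    then have "m' \<bullet> m' = (m \<bullet> m') * (m \<bullet> m')" using norm by (metis inner_scaleR_left)
    then have "m \<bullet> m' = 1 \<or> m \<bullet> m' = -1" using norm by (simp add: square_eq_1_iff)
    then show ?thesis using m'eq by (metis scaleR_minus1_left scaleR_one)
  qed
  then have "{m. outer_normal T F m} \<subseteq> {m, - m}" by auto
  then show ?thesis by (rule finite_subset) simp
qed simp

lemma finite_dihedral_angles: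
  fixes T :: "(real^'n) set"
  assumes "polytope T" "aff_dim T = int CARD('n)"
  shows "finite (dihedral_angles T)"
proof -
  let ?N = "\<Union>F\<in>{F. F facet_of T}. {m. outer_normal T F m}"
  have "finite ?N"
    using finite_polytope_facets[OF assms(1)] finite_outer_normals[OF assms(2)] by auto
  moreover have "dihedral_angles T \<subseteq> (\<lambda>(m, n). pi - vector_angle m n) ` (?N \<times> ?N)"
    unfolding dihedral_angles_def by fastforce
  ultimately show ?thesis by (meson finite_SigmaI finite_imageI finite_subset)
qed

text \<open>The distance of \<open>u\<close> from the direction space is at least
  \<open>|n \<bullet> u|\<close>, hence positive, and at most \<open>norm u\<close> because that
  space contains \<open>0\<close>. So the argument of \<open>arcsin\<close> lies in
  \<open>(0, 1]\<close>.\<close>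

lemma sin_hyperplane_angle_pos:
  assumes "S \<subseteq> {x. n \<bullet> x = c}" "norm n = 1" "n \<bullet> u \<noteq> 0"
  shows "0 < sin (hyperplane_angle u S)"
proof -
  have 0: "0 \<in> direction S" by (simp add: direction_def span_zero)
  have "\<bar>n \<bullet> u - 0\<bar> \<le> infdist u (direction S)"
    using 0 assms by (intro infdist_ge_hyperplane direction_subset_hyperplane) auto
  then have pos: "0 < infdist u (direction S)" using assms(3) by simp
  have "u \<noteq> 0" using assms(3) by auto
  moreover have "infdist u (direction S) \<le> norm u"
    using infdist_le[OF 0, of u] by simp
  ultimately have "0 < infdist u (direction S) / norm u" "infdist u (direction S) / norm u \<le> 1"
    using pos by auto
  then show ?thesis by (simp add: hyperplane_angle_def)
qed

lemma sin_angle_pos: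
  assumes geometry: "prism_family T F M G b" "F facet_of T"
    and normal: "norm n = 1" "T \<subseteq> {x. n \<bullet> x \<le> c}" "F = T \<inter> {x. n \<bullet> x = c}"
    and height: "\<And>i. i < M \<Longrightarrow> n \<bullet> b i \<noteq> 0"
    and \<theta>: "\<theta> \<in> axis_angles M G b \<union> edge_angles T \<union> dihedral_angles T"
  shows "0 < sin \<theta>"
proof -
  have "0 < sin \<theta>" if axis: "\<theta> \<in> axis_angles M G b"
  proof -
    obtain i where i: "i < M" "\<theta> = hyperplane_angle (b i) (G i)"
      using axis unfolding axis_angles_def by blast
    have "G i \<subseteq> {x. n \<bullet> x = c}"
      using prism_family_geometry(1)[OF geometry normal] normal(3) i(1) by blast
    then show ?thesis
      using sin_hyperplane_angle_pos[OF _ normal(1) height[OF i(1)]] i(2) by blast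
  qed
  then show ?thesis using \<theta> sin_edge_angle_pos sin_dihedral_angle_pos by blast
qed

lemma finite_angles:
  assumes "simplicial_element T \<or> box_element T"
  shows "finite (axis_angles M G b \<union> edge_angles T \<union> dihedral_angles T)"
proof -
  have "axis_angles M G b = (\<lambda>i. hyperplane_angle (b i) (G i)) ` {..<M}"
    by (auto simp: axis_angles_def)
  then show ?thesis
    using finite_edge_angles[OF element_polytope(1)[OF assms]]
      finite_dihedral_angles[OF element_polytope[OF assms]] by simp
qed

section \<open>Trace inequality on elements\<close>

text \<open>The subface \<open>G\<close> enters through its indicator only: the measure stays that
  of \<open>F\<close>, so that the bounds for several subfaces can be added.\<close>

lemma gaussian_prism_trace_le:
  fixes F :: "(real^'n) set" and v :: "real^'n \<Rightarrow> real"
  defines "w \<equiv> \<lambda>x. (v x)\<^sup>2 * exp (- (norm x)\<^sup>2 / 2)"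
  assumes v: "v \<in> poly_space p"
    and F: "aff_dim F = int CARD('n) - 1" "F \<noteq> {}" "F \<subseteq> {x. n \<bullet> x = c}" "norm n = 1"
    and \<rho>: "0 < \<rho>" "\<rho> \<le> \<bar>n \<bullet> b\<bar>"
    and G: "closed G" and T: "closed T"
    and prism: "\<And>x t. x \<in> G \<Longrightarrow> 0 \<le> t \<Longrightarrow> t \<le> 1 \<Longrightarrow> x + t *\<^sub>R b \<in> T"
    and K: "\<delta> * h + h\<^sup>2 / 2 = K" "\<And>x. x \<in> G \<Longrightarrow> norm x \<le> \<delta>" "norm b \<le> h"
  shows "(\<integral>\<^sup>+ s. ennreal (w s) * indicator G s \<partial>flat_measure F)
    \<le> ennreal ((K + real p + 3)\<^sup>2 / \<rho>) * (\<integral>\<^sup>+ x. ennreal (w x) * indicator T x \<partial>lborel)"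
proof -
  define C where "C = (K + real p + 3)\<^sup>2"
  have C: "0 \<le> C" by (simp add: C_def)
  have [measurable]: "w \<in> borel_measurable borel"
    unfolding w_def
    by (intro borel_measurable_continuous_onI continuous_intros continuous_on_poly_space[OF v]) auto
  have [measurable]: "T \<in> sets borel" "G \<in> sets borel" using T G by auto
  define g where "g = (\<lambda>x. ennreal (w x) * indicator T x)"
  have g [measurable]: "g \<in> borel_measurable borel" unfolding g_def by measurable
  define X where "X = (\<integral>\<^sup>+ s. (\<integral>\<^sup>+ t. g (s + t *\<^sub>R b) \<partial>lborel) \<partial>flat_measure F)"
  have "(\<integral>\<^sup>+ s. ennreal (w s) * indicator G s \<partial>flat_measure F)
      \<le> (\<integral>\<^sup>+ s. ennreal C * (\<integral>\<^sup>+ t. g (s + t *\<^sub>R b) \<partial>lborel) \<partial>flat_measure F)"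
  proof (rule nn_integral_mono)
    fix s
    show "ennreal (w s) * indicator G s \<le> ennreal C * (\<integral>\<^sup>+ t. g (s + t *\<^sub>R b) \<partial>lborel)"
    proof (cases "s \<in> G")
      case True
      have "ennreal (w s) \<le> ennreal C *
          (\<integral>\<^sup>+ t. ennreal (w (s + t *\<^sub>R b)) * indicator {0..1} t \<partial>lborel)"
        unfolding w_def C_def by (rule gaussian_trace_le[OF v K(1) K(2)[OF True] K(3)])
      \<comment> \<open>On \<open>0 <= t <= 1\<close> the segment stays in \<open>T\<close>, so the
        indicator of the unit interval is dominated by that of \<open>T\<close>.\<close>
      also have "\<dots> \<le> ennreal C * (\<integral>\<^sup>+ t. g (s + t *\<^sub>R b) \<partial>lborel)"
        using prism[OF True]
        by (intro mult_left_mono nn_integral_mono) (auto simp: g_def split: split_indicator)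
      finally show ?thesis using True by simp
    qed simp
  qed
  also have "\<dots> = ennreal C * X"
    unfolding X_def by (rule nn_integral_cmult) measurable
  \<comment> \<open>Instead of dividing by the height \<open>|n \<bullet> b|\<close>, a factor
    \<open>\<rho>\<close> is split off and enlarged to that height; this works even if
    \<open>X\<close> is infinite.\<close>
  also have "\<dots> = ennreal (C / \<rho>) * (ennreal \<rho> * X)"
    using \<rho>(1) C by (simp add: mult.assoc[symmetric] flip: ennreal_mult)
  also have "\<dots> \<le> ennreal (C / \<rho>) * (ennreal \<bar>n \<bullet> b\<bar> * X)"
    using \<rho>(2) by (intro mult_left_mono mult_right_mono ennreal_leI) auto
  also have "ennreal \<bar>n \<bullet> b\<bar> * X = (\<integral>\<^sup>+ x. g x \<partial>lborel)"
    unfolding X_def using \<rho> by (intro nn_integral_flat_measure_oblique[OF F(1-3) F(4) _ g]) auto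
  finally show ?thesis by (simp add: C_def g_def)
qed

theorem lemma5p2:
  fixes T F :: "(real^'n) set"
    and v :: "real^'n \<Rightarrow> real"
    and p M :: nat
    and G :: "nat \<Rightarrow> (real^'n) set"
    and b :: "nat \<Rightarrow> real^'n"
    and \<Theta> :: "real set"
  assumes "simplicial_element T \<or> box_element T"
    and "1 \<le> p"
    and "v \<in> poly_space p"
    and "F facet_of T"
    and "prism_family T F M G b"
    and "axis_angles M G b \<subseteq> \<Theta>"
    and "\<Theta> \<subseteq> axis_angles M G b \<union> edge_angles T \<union> dihedral_angles T"
  shows "(LINT s:F|flat_measure F. (v s)\<^sup>2 * exp (- (norm s)\<^sup>2 / 2))
           \<le> c_inv T p M \<Theta> * ((real p)\<^sup>2 / diameter T) *
               (LINT x:T|lborel. (v x)\<^sup>2 * exp (- (norm x)\<^sup>2 / 2))"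
proof -
  note v = assms(3) and facet = assms(4) and fam = assms(5)
  note poly = element_polytope(1)[OF assms(1)] and dim = element_polytope(2)[OF assms(1)]
  have compT: "compact T" using poly by (rule polytope_imp_compact)
  have F: "F \<noteq> {}" "aff_dim F = int CARD('n) - 1"
    using facet dim by (auto simp: facet_of_def)
  obtain n where "outer_normal T F n" using facet_outer_normal[OF poly facet] .
  then obtain c where normal: "norm n = 1" "T \<subseteq> {x. n \<bullet> x \<le> c}" "F = T \<inter> {x. n \<bullet> x = c}"
    unfolding outer_normal_def by blast
  note geometry = prism_family_geometry[OF fam facet normal]
  have "compact F" unfolding normal(3)
    by (intro compact_Int_closed compT closed_hyperplane)
  then have [measurable]: "F \<in> sets borel" "T \<in> sets borel" using compT by (auto intro: borel_compact)
  have GF: "G i \<subseteq> F" if "i < M" for i using geometry(1) that by auto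
  have [measurable]: "G i \<in> sets borel" if "i < M" for i using geometry(2) that by auto
  have intT: "interior T \<noteq> {}"
    using dim poly rel_interior_eq_empty[of T] polytope_imp_convex[OF poly] interior_rel_interior_gen[of T]
    by auto
  have inr: "0 < inradius T" "inradius T \<le> \<bar>n \<bullet> b i\<bar>" if "i < M" for i
    using inradius_le_half_width[OF intT normal(1,2) geometry(4)[OF that]] by auto
  have "0 < M" using geometry(1) F(1) by (cases M) auto
  define \<rho> where "\<rho> = inradius T"
  have \<rho>: "0 < \<rho>" using inr(1)[OF \<open>0 < M\<close>] by (simp add: \<rho>_def)
  define h where "h = diameter T"
  define \<delta> where "\<delta> = origin_radius T"
  define K where "K = \<delta> * h + h\<^sup>2 / 2"
  define m where "m = (MIN \<theta>\<in>\<Theta>. sin \<theta>)"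
  define w where "w = (\<lambda>x. (v x)\<^sup>2 * exp (- (norm x)\<^sup>2 / 2))"
  have w0: "0 \<le> w x" for x by (simp add: w_def)
  have wc: "continuous_on S w" for S
    unfolding w_def by (intro continuous_intros continuous_on_poly_space[OF v]) auto
  have [measurable]: "w \<in> borel_measurable borel"
    by (intro borel_measurable_continuous_onI wc)
  have bT: "norm (b i) \<le> h" if i: "i < M" for i
  proof -
    obtain x where x: "x \<in> G i" using geometry(2)[OF i] by auto
    have "x \<in> T" "x + b i \<in> T"
      using geometry(3)[OF i x, of 0] geometry(3)[OF i x, of 1] by auto
    then have "dist (x + b i) x \<le> h"
      unfolding h_def using compT by (intro diameter_bounded_bound compact_imp_bounded)
    then show ?thesis by (simp add: dist_norm)
  qed
  have h: "0 < h"
    using inr[OF \<open>0 < M\<close>] bT[OF \<open>0 < M\<close>] Cauchy_Schwarz_ineq2[of n "b 0"] normal(1) by simp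
  have \<delta>: "norm x \<le> \<delta>" if "x \<in> T" for x
    unfolding \<delta>_def origin_radius_def closure_closed[OF compact_imp_closed[OF compT]]
  proof (rule cSUP_upper[OF that])
    show "bdd_above (norm ` T)"
      using compT
      by (intro bounded_imp_bdd_above compact_imp_bounded compact_continuous_image continuous_intros)
  qed
  \<comment> \<open>On a finite nonempty set the minimum is attained, so \<open>m\<close> is the
    sine of one of the angles and lies in \<open>(0, 1]\<close>.\<close>
  have "finite \<Theta>" using finite_angles[OF assms(1)] assms(7) by (rule finite_subset[rotated])
  moreover have "\<Theta> \<noteq> {}" using \<open>0 < M\<close> assms(6) by (auto simp: axis_angles_def)
  ultimately have "m \<in> sin ` \<Theta>" unfolding m_def by (intro Min_in) auto
  then obtain \<theta> where \<theta>: "\<theta> \<in> \<Theta>" "m = sin \<theta>" by auto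
  have nz: "n \<bullet> b i \<noteq> 0" if "i < M" for i using inr[OF that] by auto
  have m: "0 < m" "m \<le> 1"
    using sin_angle_pos[OF fam facet normal nz] \<theta> assms(7) by auto
  define I where "I = (LINT x:T|lborel. w x)"
  have I0: "0 \<le> I" unfolding I_def set_lebesgue_integral_def
    by (intro Bochner_Integration.integral_nonneg) (simp add: w0)
  have "set_integrable lborel T w"
    unfolding set_integrable_def using compT wc by (rule borel_integrable_compact)
  then have "(\<integral>\<^sup>+ x. ennreal (indicator T x *\<^sub>R w x) \<partial>lborel) = ennreal I"
    unfolding I_def set_integrable_def set_lebesgue_integral_def
    by (rule nn_integral_eq_integral) (simp add: w0)
  moreover have "(\<integral>\<^sup>+ x. ennreal (indicator T x *\<^sub>R w x) \<partial>lborel)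
      = (\<integral>\<^sup>+ x. ennreal (w x) * indicator T x \<partial>lborel)"
    by (intro nn_integral_cong) (auto split: split_indicator)
  ultimately have nnI: "(\<integral>\<^sup>+ x. ennreal (w x) * indicator T x \<partial>lborel) = ennreal I"
    by simp
  define D where "D = real M * ((K + real p + 3)\<^sup>2 / \<rho>)"
  have D0: "0 \<le> D" using \<rho> by (simp add: D_def)
  \<comment> \<open>Each point of \<open>F\<close> lies in some subface and the integrand is
    nonnegative, so the integral over \<open>F\<close> is at most the sum over the subfaces.\<close>
  have "(\<integral>\<^sup>+ s. ennreal (w s) * indicator F s \<partial>flat_measure F)
      \<le> (\<integral>\<^sup>+ s. (\<Sum>i<M. ennreal (w s) * indicator (G i) s) \<partial>flat_measure F)"
  proof (rule nn_integral_mono)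
    fix s
    show "ennreal (w s) * indicator F s \<le> (\<Sum>i<M. ennreal (w s) * indicator (G i) s)"
    proof (cases "s \<in> F")
      case True
      then obtain i where i: "i < M" "s \<in> G i" using geometry(1) by auto
      have "ennreal (w s) * indicator (G i) s \<le> (\<Sum>i<M. ennreal (w s) * indicator (G i) s)"
        using i(1) by (intro member_le_sum) auto
      then show ?thesis using i True by simp
    qed simp
  qed
  also have "\<dots> = (\<Sum>i<M. \<integral>\<^sup>+ s. ennreal (w s) * indicator (G i) s \<partial>flat_measure F)"
    by (rule nn_integral_sum) auto
  also have "\<dots> \<le> (\<Sum>i<M. ennreal ((K + real p + 3)\<^sup>2 / \<rho>) * ennreal I)"
  proof (rule sum_mono)
    fix i assume "i \<in> {..<M}"
    then have i: "i < M" by simp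
    show "(\<integral>\<^sup>+ s. ennreal (w s) * indicator (G i) s \<partial>flat_measure F)
        \<le> ennreal ((K + real p + 3)\<^sup>2 / \<rho>) * ennreal I"
      unfolding nnI[symmetric] w_def
    proof (rule gaussian_prism_trace_le[OF v F(2,1) _ normal(1) \<rho>])
      show "F \<subseteq> {x. n \<bullet> x = c}" using normal(3) by auto
      show "\<rho> \<le> \<bar>n \<bullet> b i\<bar>" using inr(2)[OF i] by (simp add: \<rho>_def)
      show "closed (G i)" using geometry(2)[OF i] by auto
      show "closed T" using compT by (rule compact_imp_closed)
      show "x + t *\<^sub>R b i \<in> T" if "x \<in> G i" "0 \<le> t" "t \<le> 1" for x t
        using geometry(3)[OF i that] .
      show "\<delta> * h + h\<^sup>2 / 2 = K" by (simp add: K_def)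
      show "norm x \<le> \<delta>" if "x \<in> G i" for x
        using GF[OF i] normal(3) that by (intro \<delta>) auto
      show "norm (b i) \<le> h" by (rule bT[OF i])
    qed
  qed
  also have "\<dots> = ennreal (D * I)"
    using \<rho> I0
    by (simp add: D_def ennreal_of_nat_eq_real_of_nat mult.assoc flip: ennreal_mult)
  finally have nnF: "(\<integral>\<^sup>+ s. ennreal (w s) * indicator F s \<partial>flat_measure F) \<le> ennreal (D * I)" .
  have "(LINT s:F|flat_measure F. w s) = enn2real (\<integral>\<^sup>+ s. ennreal (indicator F s *\<^sub>R w s) \<partial>flat_measure F)"
    unfolding set_lebesgue_integral_def by (intro integral_eq_nn_integral) (auto simp: w0)
  also have "(\<integral>\<^sup>+ s. ennreal (indicator F s *\<^sub>R w s) \<partial>flat_measure F)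
      = (\<integral>\<^sup>+ s. ennreal (w s) * indicator F s \<partial>flat_measure F)"
    by (intro nn_integral_cong) (auto split: split_indicator)
  also have "enn2real \<dots> \<le> D * I"
    using nnF D0 I0 by (intro enn2real_leI) auto
  \<comment> \<open>The sine only enlarges the bound, since \<open>m <= 1\<close>.\<close>
  also have "\<dots> \<le> (D / m) * I"
    using m D0 I0 by (intro mult_right_mono) (auto simp: le_divide_eq mult_left_le)
  also have "D / m = c_inv T p M \<Theta> * ((real p)\<^sup>2 / diameter T)"
  proof -
    \<comment> \<open>The bracket in \<open>c_inv\<close> is twice \<open>K + p + 3\<close>. Its
      square yields the \<open>4\<close> that cancels the one in the denominator, while
      \<open>p^2\<close> and \<open>h\<close> cancel because \<open>p >= 1\<close> and
      \<open>h > 0\<close>.\<close>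
    have "(h\<^sup>2 + 2 * \<delta> * h + 2 * real p + 6)\<^sup>2 = (2 * (K + real p + 3))\<^sup>2"
      by (simp add: K_def algebra_simps)
    also have "\<dots> = 4 * (K + real p + 3)\<^sup>2" by (simp only: power_mult_distrib) simp
    finally have "c_inv T p M \<Theta> * ((real p)\<^sup>2 / diameter T)
        = real M * h * (4 * (K + real p + 3)\<^sup>2) / (4 * \<rho> * (real p)\<^sup>2 * m) * ((real p)\<^sup>2 / h)"
      by (simp add: c_inv_def h_def \<delta>_def \<rho>_def m_def)
    also have "\<dots> = D / m"
      using h \<rho> m assms(2) by (simp add: D_def)
    finally show ?thesis ..
  qed
  finally show ?thesis by (simp add: w_def I_def)
qed

end
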